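(* Let $\{X_n:n\ge0\}$ be a Markov chain on a measurable space $(S,\mathcal{B})$ with transition probability $P$, which is reversible with respect to its (unique) invariant probability measure $\pi$, and suppose that $P(x,dy)\ge\tilde\beta\,\mathbb{1}_C(x)\,\nu(dy)$ for some set $C\in\mathcal{B}$, some $\tilde\beta>0$ and some probability measure $\nu$ on $(S,\mathcal{B})$. Let $\{u_n:n\ge0\}$ be the renewal sequence given by $u_0=1$ and $u_n=\tilde\beta\,\mathbf{P}^\nu(X_{n-1}\in C)$ for $n\ge1$, and suppose that the corresponding increment sequence $\{b_n:n\ge1\}$ (a probability distribution on the positive integers) satisfies $\sum_{n=1}^\infty b_nR^n\le L$ and $b_1\ge\beta$ for some constants $R>1$, $L<\infty$ and $\beta>0$. If $L>1+2\beta R$, let $R_2=R_2(\beta,R,L)$ be the unique solution $r\in(1,R)$ of $$1+2\beta r=r^{(\log L)/(\log R)},$$ and let $R_2=R$ otherwise. Then the series $$\sum_{n=0}^\infty(u_n-u_\infty)z^n$$ has radius of convergence at least $R_2$. Moreover, if $$\lim_{n\to\infty}\left|\int_CP^n\mathbb{1}_C(x)\,\pi(dx)-(\pi(C))^2\right|r^n<\infty\qquad\text{for all }0<r<R_2,$$ then, for $1<r<R_2$, $$\sum_{n=1}^\infty|u_n-u_\infty|r^n\le\frac{\sqrt{\tilde\beta}\,r}{1-r/R_2}.$$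
   Context: The Markov chain is time homogeneous; $P$ also denotes the operator $Pf(x)=\int f(y)P(x,dy)$. Reversible with respect to $\pi$ means $\pi(dx)P(x,dy)=\pi(dy)P(y,dx)$ as measures on $S\times S$. $\mathbf{P}^\nu$ is the law of the chain with $X_0\sim\nu$. Renewal sequences: for a probability distribution $\{b_n\}_{n\ge1}$ on the positive integers (the increment sequence; $\sum_n b_n=1$), the corresponding renewal sequence is $u_0=1$, $u_n=\sum_{k=1}^nb_ku_{n-k}$ for $n\ge1$; equivalently $u_n$ is the probability that the partial sums (including the empty sum) of i.i.d. variables with law $\{b_n\}$ hit $n$. $u_\infty=\lim_{n\to\infty}u_n$. *)

theory Defs
  imports "HOL-Probability.Probability"
begin

text \<open>Throughout, a measurable space is represented by a measure \<open>S\<close> of which only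
  \<open>space S\<close> and \<open>sets S\<close> matter. A transition probability on it is an element of
  \<open>measurable S (prob_algebra S)\<close>, a probability measure on it an element of
  \<open>space (prob_algebra S)\<close>.\<close>

definition invariant_prob ::
    "'a measure \<Rightarrow> ('a \<Rightarrow> 'a measure) \<Rightarrow> 'a measure \<Rightarrow> bool" where
  "invariant_prob S P \<mu> \<longleftrightarrow> \<mu> \<in> space (prob_algebra S) \<and> bind \<mu> P = \<mu>"

text \<open>Both sides are measures on \<open>S \<times> S\<close> in the variables \<open>(x, y)\<close>: the left one is
  \<open>\<mu>(dx) P(x, dy)\<close>, the right one is \<open>\<mu>(dy) P(y, dx)\<close>.\<close>

definition reversible_wrt ::
    "'a measure \<Rightarrow> ('a \<Rightarrow> 'a measure) \<Rightarrow> 'a measure \<Rightarrow> bool" where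
  "reversible_wrt S P \<mu> \<longleftrightarrow>
     bind \<mu> (\<lambda>x. bind (P x) (\<lambda>y. return (S \<Otimes>\<^sub>M S) (x, y))) =
     bind \<mu> (\<lambda>y. bind (P y) (\<lambda>x. return (S \<Otimes>\<^sub>M S) (x, y)))"

definition transition_op :: "('a \<Rightarrow> 'a measure) \<Rightarrow> ('a \<Rightarrow> real) \<Rightarrow> 'a \<Rightarrow> real" where
  "transition_op P f = (\<lambda>x. \<integral>y. f y \<partial>P x)"

text \<open>The law, on the path space \<open>PiM UNIV (\<lambda>_. S)\<close>, of the time-homogeneous Markov chain
  with initial distribution \<open>\<nu>\<close> and transition probability \<open>P\<close>, obtained from the
  Ionescu-Tulcea construction: coordinate \<open>0\<close> has law \<open>\<nu>\<close>, and given the coordinates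
  below \<open>Suc n\<close> the conditional law of coordinate \<open>Suc n\<close> is \<open>P (\<omega> n)\<close>.
  The \<open>n\<close>-th state \<open>X n\<close> of the chain is the coordinate map \<open>\<lambda>\<omega>. \<omega> n\<close>.\<close>

definition chain_step ::
    "('a \<Rightarrow> 'a measure) \<Rightarrow> 'a measure \<Rightarrow> nat \<Rightarrow> (nat \<Rightarrow> 'a) \<Rightarrow> 'a measure" where
  "chain_step P \<nu> i \<omega> = (case i of 0 \<Rightarrow> \<nu> | Suc n \<Rightarrow> P (\<omega> n))"

definition chain_law ::
    "'a measure \<Rightarrow> ('a \<Rightarrow> 'a measure) \<Rightarrow> 'a measure \<Rightarrow> (nat \<Rightarrow> 'a) measure" where
  "chain_law S P \<nu> =
     projective_family.lim UNIV (Ionescu_Tulcea.CI (chain_step P \<nu>) (\<lambda>_. S)) (\<lambda>_. S)"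

text \<open>Increment sequences are indexed by the positive integers; the value at \<open>0\<close> of the
  representing function is never used.\<close>

definition increment_sequence :: "(nat \<Rightarrow> real) \<Rightarrow> bool" where
  "increment_sequence b \<longleftrightarrow> (\<forall>n\<ge>1. 0 \<le> b n) \<and> (\<lambda>n. b (Suc n)) sums 1"

definition renewal_sequence_of :: "(nat \<Rightarrow> real) \<Rightarrow> (nat \<Rightarrow> real) \<Rightarrow> bool" where
  "renewal_sequence_of b u \<longleftrightarrow>
     u 0 = 1 \<and> (\<forall>n\<ge>1. u n = (\<Sum>k=1..n. b k * u (n - k)))"

definition R2_solution :: "real \<Rightarrow> real \<Rightarrow> real \<Rightarrow> real \<Rightarrow> bool" where
  "R2_solution \<beta> R L r \<longleftrightarrow> 1 < r \<and> r < R \<and> 1 + 2 * \<beta> * r = r powr (ln L / ln R)"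

definition R2 :: "real \<Rightarrow> real \<Rightarrow> real \<Rightarrow> real" where
  "R2 \<beta> R L = (if L > 1 + 2 * \<beta> * R then (THE r. R2_solution \<beta> R L r) else R)"

end

theory Submission
  imports Defs "HOL-Complex_Analysis.Complex_Analysis"
begin

text \<open>Write \<open>U z\<close> for the sum of \<open>u n * z ^ n\<close> and \<open>\<phi> z\<close> for the sum of \<open>b n * z ^ n\<close>.
  The renewal equation says \<open>(1 - \<phi> z) * U z = 1\<close> in the unit disk, and \<open>\<phi>\<close> is holomorphic for
  \<open>norm z < R\<close>. So \<open>U\<close> continues meromorphically to that disk, its poles are the solutions of
  \<open>\<phi> z = 1\<close>, and the one at \<open>1\<close>, which is simple, is responsible for the limit of \<open>u\<close>. The
  radius of convergence of the deviations from the limit is at least the modulus of the nearest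
  other solution.

  Reversibility confines these solutions to the real line. The transition operator is
  a self-adjoint contraction of \<open>L\<^sup>2(\<pi>)\<close>, and \<open>u (n + 1) = \<beta>' * \<integral> P\<^sup>n 1\<^sub>C d\<nu>\<close> is
  a bounded linear functional of \<open>P\<^sup>n 1\<^sub>C\<close> there, since invariance turns the minorization into
  \<open>\<beta>' * \<pi>(C) * \<nu> \<le> \<pi>\<close>. By the spectral theorem \<open>U\<close> is therefore holomorphic off the two
  real rays \<open>\<bar>x\<bar> \<ge> 1\<close>. The proof replaces the spectral theorem by an expansion: with
  \<open>z = 2 q / (1 + q\<^sup>2)\<close>, which maps the unit disk onto the cut plane, the resolvent
  \<open>(1 - z P)^(-1)\<close> is, up to a scalar factor, a power series in \<open>q\<close> with the Chebyshev polynomials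
  \<open>1\<close> and \<open>2 T\<^sub>n(P)\<close> as coefficients, and the \<open>T\<^sub>n(P)\<close> are contractions because
  \<open>T\<^sub>n\<^sup>2 + (1 - X\<^sup>2) V\<^sub>n\<^sup>2 = 1\<close>, with \<open>V\<^sub>n\<close> the polynomials of the second kind, of degree \<open>n - 1\<close>,
  and \<open>1 - P\<^sup>2\<close> is a nonnegative operator
  (\<open>chebyshev_resolvent\<close>, \<open>cheb_energy\<close>). Comparing the two
  continuations of \<open>U\<close> excludes nonreal solutions of \<open>\<phi> z = 1\<close>.

  On the positive axis \<open>1\<close> is the only solution by monotonicity. At \<open>- r\<close> with \<open>r \<ge> 1\<close> the term
  \<open>b 1\<close> changes sign, so \<open>\<phi> (- r) \<le> \<phi> r - 2 * b 1 * r\<close>, and this is below \<open>1\<close> as long as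
  \<open>\<phi> r < 1 + 2 * \<beta> * r\<close>, where \<open>\<beta> \<le> b 1\<close>. Convexity of \<open>\<phi>\<close>, or its
  logarithmic convexity in \<open>ln r\<close> when \<open>L > 1 + 2 * \<beta> * R\<close>, gives this for
  \<open>1 \<le> r < R2 \<beta> R L\<close> (\<open>real_gf_less_affine_below_R2\<close>).

  For the explicit bound put \<open>h = 1\<^sub>C - \<pi>(C)\<close>. The squared norms of \<open>P\<^sup>n h\<close> form a log-convex
  sequence, so the assumed decay rate of the correlations of \<open>h\<close> holds with constant
  \<open>\<parallel>h\<parallel>\<^sup>2 \<le> \<pi>(C)\<close>; applying the functional \<open>\<beta>' * \<nu>\<close>, whose squared norm is at most
  \<open>\<beta>' / \<pi>(C)\<close>, makes \<open>\<pi>(C)\<close> cancel (\<open>geometric_bound\<close>).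

  All this needs \<open>\<pi>(C) > 0\<close>, and this is where uniqueness of \<open>\<pi>\<close> enters: the occupation measure of
  one regeneration cycle, whose mean length is finite because of the exponential moment,
  normalizes to an invariant probability that charges \<open>C\<close> (\<open>invariant_prob_cycle_mean\<close>), so it
  must be \<open>\<pi>\<close>.\<close>

section \<open>Power series with a Chebyshev recurrence extend to the cut plane\<close>

lemma powser_bounded_summable:
  fixes a :: "nat \<Rightarrow> complex"
  assumes "\<And>n. norm (a n) \<le> B" "norm z < 1"
  shows "summable (\<lambda>n. norm (a n * z ^ n))"
proof (rule summable_comparison_test)
  show "summable (\<lambda>n. B * norm z ^ n)"
    using assms(2) by (intro summable_mult summable_geometric) simp
  show "\<exists>N. \<forall>n\<ge>N. norm (norm (a n * z ^ n)) \<le> B * norm z ^ n"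
    using assms(1) by (auto simp: norm_mult norm_power intro!: mult_right_mono)
qed

text \<open>The model is \<open>w n k = \<ell> (A\<^sup>k T\<^sub>n(A) f)\<close> for an operator \<open>A\<close>, a linear functional \<open>\<ell>\<close> and
  Chebyshev polynomials of the first kind. Then the claim is the expansion of the resolvent,
  \<open>(1 - q\<^sup>2) / (1 - 2 q A + q\<^sup>2) = 1 + 2 \<Sum> T\<^sub>n(A) q\<^sup>n\<close> over \<open>n \<ge> 1\<close>, with
  \<open>1 - z A = (1 - 2 q A + q\<^sup>2) / (1 + q\<^sup>2)\<close>.\<close>

lemma chebyshev_resolvent:
  fixes w :: "nat \<Rightarrow> nat \<Rightarrow> complex"
  assumes bd: "\<And>n k. norm (w n k) \<le> B"
    and w1: "\<And>k. w (Suc 0) k = w 0 (Suc k)"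
    and w2: "\<And>n k. w (Suc (Suc n)) k = 2 * w (Suc n) (Suc k) - w n k"
    and z: "norm z < 1" and q: "norm q < 1" and zq: "z * (1 + q\<^sup>2) = 2 * q"
  shows "(1 - q\<^sup>2) * (\<Sum>k. w 0 k * z ^ k) = (1 + q\<^sup>2) * (2 * (\<Sum>n. w n 0 * q ^ n) - w 0 0)"
proof -
  define H where "H n = (\<Sum>k. w n k * z ^ k)" for n
  have sm: "summable (\<lambda>k. w n k * z ^ k)" for n
    using powser_bounded_summable[of "w n" B z] bd z by (blast intro: summable_norm_cancel)
  have sm': "summable (\<lambda>k. w n (Suc k) * z ^ k)" for n
    using powser_bounded_summable[of "\<lambda>k. w n (Suc k)" B z] bd z by (blast intro: summable_norm_cancel)
  have smv: "summable (\<lambda>n. w n 0 * q ^ n)"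
    using powser_bounded_summable[of "\<lambda>n. w n 0" B q] bd q by (blast intro: summable_norm_cancel)
  have smv': "summable (\<lambda>n. w (Suc n) 0 * q ^ n)"
    using powser_bounded_summable[of "\<lambda>n. w (Suc n) 0" B q] bd q by (blast intro: summable_norm_cancel)
  have shift: "z * (\<Sum>k. w n (Suc k) * z ^ k) = H n - w n 0" for n
  proof -
    have "H n = w n 0 + (\<Sum>k. w n (Suc k) * z ^ Suc k)"
      using suminf_split_head[OF sm[of n]] by (simp add: H_def)
    also have "(\<Sum>k. w n (Suc k) * z ^ Suc k) = z * (\<Sum>k. w n (Suc k) * z ^ k)"
      using suminf_mult[OF sm'[of n], of z] by (simp add: algebra_simps)
    finally show ?thesis by simp
  qed
  have H1: "z * H (Suc 0) = H 0 - w 0 0"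
    using shift[of 0] by (simp add: H_def w1)
  have H2: "z * (H (Suc (Suc n)) + H n) = 2 * (H (Suc n) - w (Suc n) 0)" for n
  proof -
    have "H (Suc (Suc n)) + H n = (\<Sum>k. w (Suc (Suc n)) k * z ^ k + w n k * z ^ k)"
      unfolding H_def by (rule suminf_add[OF sm sm])
    also have "\<dots> = (\<Sum>k. 2 * (w (Suc n) (Suc k) * z ^ k))"
      by (simp add: w2 algebra_simps)
    also have "\<dots> = 2 * (\<Sum>k. w (Suc n) (Suc k) * z ^ k)"
      by (rule suminf_mult[OF sm'])
    finally have "z * (H (Suc (Suc n)) + H n) = 2 * (z * (\<Sum>k. w (Suc n) (Suc k) * z ^ k))"
      by (simp only: mult.left_commute)
    also have "\<dots> = 2 * (H (Suc n) - w (Suc n) 0)" by (simp only: shift)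
    finally show ?thesis .
  qed
  \<comment> \<open>The recurrence for \<open>H\<close> has the characteristic roots \<open>q\<close> and \<open>1 / q\<close>. The combination \<open>D\<close> removes the decaying mode; the growing one is then excluded by the boundedness of \<open>H\<close>.\<close>
  define D where "D n = H (Suc n) - q * H n" for n
  have step: "q * D (Suc n) = D n - (1 + q\<^sup>2) * w (Suc n) 0" for n
  proof -
    have "2 * (q * (H (Suc (Suc n)) + H n)) = (1 + q\<^sup>2) * (z * (H (Suc (Suc n)) + H n))"
      using zq by algebra
    also have "\<dots> = 2 * ((1 + q\<^sup>2) * (H (Suc n) - w (Suc n) 0))"
      by (simp only: H2 mult.left_commute)
    finally have "q * (H (Suc (Suc n)) + H n) = (1 + q\<^sup>2) * (H (Suc n) - w (Suc n) 0)"
      by simp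
    then show ?thesis
      unfolding D_def by algebra
  qed
  have tele: "D 0 = (1 + q\<^sup>2) * (\<Sum>n<N. w (Suc n) 0 * q ^ n) + q ^ N * D N" for N
  proof (induction N)
    case (Suc N)
    have "q ^ N * D N = q ^ N * (q * D (Suc N) + (1 + q\<^sup>2) * w (Suc N) 0)"
      using step[of N] by simp
    with Suc show ?case by (simp add: algebra_simps)
  qed simp
  have Hb: "norm (H n) \<le> B / (1 - norm z)" for n
  proof -
    have "norm (H n) \<le> (\<Sum>k. norm (w n k * z ^ k))"
      unfolding H_def using powser_bounded_summable[of "w n" B z] bd z by (intro summable_norm) blast
    also have "\<dots> \<le> (\<Sum>k. B * norm z ^ k)"
      using powser_bounded_summable[of "w n" B z] bd z
      by (intro suminf_le summable_mult summable_geometric)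
         (auto simp: norm_mult norm_power intro!: mult_right_mono)
    also have "\<dots> = B / (1 - norm z)"
      using z by (subst suminf_mult) (auto simp: suminf_geometric)
    finally show ?thesis .
  qed
  have "(\<lambda>N. q ^ N * D N) \<longlonglongrightarrow> 0"
  proof (rule Lim_null_comparison)
    show "\<forall>\<^sub>F N in sequentially. norm (q ^ N * D N) \<le> norm q ^ N * (B / (1 - norm z) + norm q * (B / (1 - norm z)))"
    proof (intro always_eventually allI)
      fix N
      have "norm (D N) \<le> norm (H (Suc N)) + norm q * norm (H N)"
        unfolding D_def using norm_triangle_ineq4 by (metis norm_mult)
      also have "\<dots> \<le> B / (1 - norm z) + norm q * (B / (1 - norm z))"
        by (intro add_mono mult_left_mono Hb) auto
      finally show "norm (q ^ N * D N) \<le> norm q ^ N * (B / (1 - norm z) + norm q * (B / (1 - norm z)))"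
        by (simp add: norm_mult norm_power mult_left_mono)
    qed
    show "(\<lambda>N. norm q ^ N * (B / (1 - norm z) + norm q * (B / (1 - norm z)))) \<longlonglongrightarrow> 0"
      using q by (intro tendsto_mult_left_zero LIMSEQ_power_zero) simp
  qed
  then have "(\<lambda>N. (1 + q\<^sup>2) * (\<Sum>n<N. w (Suc n) 0 * q ^ n) + q ^ N * D N) \<longlonglongrightarrow>
      (1 + q\<^sup>2) * (\<Sum>n. w (Suc n) 0 * q ^ n) + 0"
    by (intro tendsto_add tendsto_mult tendsto_const summable_LIMSEQ smv')
  then have D0: "D 0 = (1 + q\<^sup>2) * (\<Sum>n. w (Suc n) 0 * q ^ n)"
    unfolding tele[symmetric] by (simp add: LIMSEQ_const_iff)
  have V: "q * (\<Sum>n. w (Suc n) 0 * q ^ n) = (\<Sum>n. w n 0 * q ^ n) - w 0 0"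
    using suminf_split_head[OF smv] suminf_mult[OF smv', of q] by (simp add: algebra_simps)
  have "2 * (q * H (Suc 0)) = (1 + q\<^sup>2) * (H 0 - w 0 0)"
    using H1 zq by algebra
  with D0 V have "(1 - q\<^sup>2) * H 0 = (1 + q\<^sup>2) * (2 * (\<Sum>n. w n 0 * q ^ n) - w 0 0)"
    unfolding D_def by algebra
  then show ?thesis by (simp add: H_def)
qed

text \<open>On the right of the previous identity \<open>z\<close> enters only through \<open>q\<close>, and that side makes sense
  whenever \<open>norm q < 1\<close>. Solving \<open>z (1 + q\<^sup>2) = 2 q\<close> for the small root gives
  \<open>q = z / (1 + sqrt (1 - z\<^sup>2))\<close>, which has modulus below \<open>1\<close> on the whole cut plane.\<close>

lemma chebyshev_cut_plane_extension:
  fixes w :: "nat \<Rightarrow> nat \<Rightarrow> complex"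
  assumes bd: "\<And>n k. norm (w n k) \<le> B"
    and w1: "\<And>k. w (Suc 0) k = w 0 (Suc k)"
    and w2: "\<And>n k. w (Suc (Suc n)) k = 2 * w (Suc n) (Suc k) - w n k"
  obtains M where "M holomorphic_on {z. Im z = 0 \<longrightarrow> \<bar>Re z\<bar> < 1}"
    and "\<And>z. norm z < 1 \<Longrightarrow> M z = (\<Sum>k. w 0 k * z ^ k)"
proof -
  define cut where "cut = {z. Im z = 0 \<longrightarrow> \<bar>Re z\<bar> < 1}"
  define s where "s z = csqrt (1 - z\<^sup>2)" for z
  define q where "q z = z / (1 + s z)" for z
  define V where "V x = (\<Sum>n. w n 0 * x ^ n)" for x
  have nonneg: "1 - z\<^sup>2 \<notin> \<real>\<^sub>\<le>\<^sub>0" if "z \<in> cut" for z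
  proof
    assume "1 - z\<^sup>2 \<in> \<real>\<^sub>\<le>\<^sub>0"
    then have 1: "(Re z)\<^sup>2 - (Im z)\<^sup>2 \<ge> 1" and 2: "Re z * Im z = 0"
      by (auto simp: complex_nonpos_Reals_iff power2_eq_square)
    have "Im z = 0"
    proof (rule ccontr)
      assume "Im z \<noteq> 0"
      with 2 have "Re z = 0" by simp
      with 1 show False using zero_le_power2[of "Im z"] by (simp add: not_less[symmetric])
    qed
    with 1 that show False
      by (simp add: cut_def) (metis abs_square_less_1 not_less)
  qed
  have s2: "s z * s z = 1 - z\<^sup>2" for z
    unfolding s_def by (metis power2_csqrt power2_eq_square)
  have Res: "Re (s z) > 0" if "z \<in> cut" for z
  proof (rule ccontr)
    assume "\<not> ?thesis"
    with csqrt_principal[of "1 - z\<^sup>2"] have "Re (s z) = 0" by (auto simp: s_def)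
    then have "s z * s z = - of_real ((Im (s z))\<^sup>2)"
      by (simp add: complex_eq_iff power2_eq_square)
    then have "1 - z\<^sup>2 \<in> \<real>\<^sub>\<le>\<^sub>0"
      unfolding s2 by (simp add: complex_nonpos_Reals_iff)
    with nonneg[OF that] show False by simp
  qed
  have s_nz: "s z \<noteq> 0" "1 + s z \<noteq> 0" if "z \<in> cut" for z
    using Res[OF that] by (auto simp: complex_eq_iff)
  have q2: "(q z)\<^sup>2 * (1 + s z) = 1 - s z" if "z \<in> cut" for z
  proof -
    have "(q z)\<^sup>2 * (1 + s z) * (1 + s z) = z\<^sup>2"
      using s_nz[OF that] by (simp add: q_def power2_eq_square)
    also have "\<dots> = (1 - s z) * (1 + s z)"
      using s2[of z] by (simp add: algebra_simps)
    finally show ?thesis using s_nz[OF that] by simp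
  qed
  have qn: "norm (q z) < 1" if "z \<in> cut" for z
  proof -
    have "norm (1 - s z) < norm (1 + s z)"
      using Res[OF that] by (simp add: cmod_def power2_eq_square algebra_simps)
    moreover have "norm (q z) ^ 2 * norm (1 + s z) = norm (1 - s z)"
      using q2[OF that] by (metis norm_mult norm_power)
    ultimately have "norm (q z) ^ 2 * norm (1 + s z) < 1 * norm (1 + s z)" by simp
    then have "norm (q z) ^ 2 < 1"
      by (rule mult_right_less_imp_less) simp
    then show ?thesis by (simp add: abs_square_less_1)
  qed
  have s_hol: "s holomorphic_on cut"
    unfolding s_def using nonneg by (intro holomorphic_intros) auto
  have V_hol: "V holomorphic_on ball 0 1"
  proof (rule power_series_holomorphic)
    fix x :: complex assume "x \<in> ball 0 1"
    then show "(\<lambda>n. w n 0 * (x - 0) ^ n) sums V x"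
      using powser_bounded_summable[of "\<lambda>n. w n 0" B x] bd
      by (auto simp: V_def intro!: summable_sums summable_norm_cancel)
  qed
  have q_hol: "q holomorphic_on cut"
    unfolding q_def using s_nz by (intro holomorphic_intros s_hol) auto
  have "(\<lambda>z. V (q z)) holomorphic_on cut"
    using holomorphic_on_compose_gen[OF q_hol V_hol] qn by (simp add: o_def image_subset_iff)
  then have M_hol: "(\<lambda>z. (2 * V (q z) - w 0 0) / s z) holomorphic_on cut"
    using s_nz by (intro holomorphic_intros s_hol) auto
  show thesis
  proof (rule that)
    show "(\<lambda>z. (2 * V (q z) - w 0 0) / s z) holomorphic_on {z. Im z = 0 \<longrightarrow> \<bar>Re z\<bar> < 1}"
      using M_hol by (simp add: cut_def)
    fix z :: complex assume z: "norm z < 1"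
    have zc: "z \<in> cut"
      using z abs_Re_le_cmod[of z] by (auto simp: cut_def)
    have a: "(1 + (q z)\<^sup>2) * (1 + s z) = 2" "(1 - (q z)\<^sup>2) * (1 + s z) = 2 * s z"
      using q2[OF zc] by (simp_all add: algebra_simps)
    have "z * (1 + (q z)\<^sup>2) * (1 + s z) = 2 * q z * (1 + s z)"
      using a s_nz[OF zc] by (simp add: q_def mult.assoc)
    then have "z * (1 + (q z)\<^sup>2) = 2 * q z" using s_nz[OF zc] by simp
    from chebyshev_resolvent[where w=w and B=B, OF bd w1 w2 z qn[OF zc] this]
    have "(1 - (q z)\<^sup>2) * (\<Sum>k. w 0 k * z ^ k) = (1 + (q z)\<^sup>2) * (2 * V (q z) - w 0 0)"
      by (simp add: V_def)
    then have "(1 - (q z)\<^sup>2) * (1 + s z) * (\<Sum>k. w 0 k * z ^ k)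
        = (1 + (q z)\<^sup>2) * (1 + s z) * (2 * V (q z) - w 0 0)"
      by algebra
    then have "2 * (s z * (\<Sum>k. w 0 k * z ^ k)) = 2 * (2 * V (q z) - w 0 0)"
      unfolding a by (simp only: mult.assoc)
    then have "s z * (\<Sum>k. w 0 k * z ^ k) = 2 * V (q z) - w 0 0"
      by (simp only: mult_cancel_left) simp
    then show "(2 * V (q z) - w 0 0) / s z = (\<Sum>k. w 0 k * z ^ k)"
      using s_nz[OF zc] by (simp add: field_simps)
  qed
qed

section \<open>Generating functions of renewal sequences\<close>

lemma renewal_bounded:
  assumes inc: "increment_sequence b" and ren: "renewal_sequence_of b u"
  shows "0 \<le> u n" "u n \<le> 1"
proof -
  have "0 \<le> u n \<and> u n \<le> 1"
  proof (induction n rule: less_induct)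
    case (less n)
    show ?case
    proof (cases "n = 0")
      case True
      with ren show ?thesis by (simp add: renewal_sequence_of_def)
    next
      case False
      then have un: "u n = (\<Sum>k=1..n. b k * u (n - k))"
        using ren by (simp add: renewal_sequence_of_def)
      have b: "0 \<le> b k" if "k \<ge> 1" for k
        using inc that by (simp add: increment_sequence_def)
      have u: "0 \<le> u (n - k) \<and> u (n - k) \<le> 1" if "k \<in> {1..n}" for k
        using less[of "n - k"] that by simp
      have "0 \<le> u n"
        unfolding un using b u by (intro sum_nonneg mult_nonneg_nonneg) auto
      moreover have "u n \<le> (\<Sum>k=1..n. b k * 1)"
        unfolding un using b u by (intro sum_mono mult_left_mono) auto
      moreover have "(\<Sum>k=1..n. b k) = (\<Sum>k<n. b (Suc k))"
        by (rule sum.reindex_bij_witness[of _ Suc "\<lambda>k. k - 1"]) auto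
      moreover have "(\<Sum>k<n. b (Suc k)) \<le> 1"
        using inc b sum_le_suminf[of "\<lambda>k. b (Suc k)" "{..<n}"]
        by (auto simp: increment_sequence_def sums_iff)
      ultimately show ?thesis by simp
    qed
  qed
  then show "0 \<le> u n" "u n \<le> 1" by auto
qed

definition increment_gf :: "(nat \<Rightarrow> real) \<Rightarrow> complex \<Rightarrow> complex" where
  "increment_gf b z = (\<Sum>n. of_real (b (Suc n)) * z ^ Suc n)"

text \<open>The sum of \<open>b j\<close> over \<open>j > k\<close>: the probability that a cycle lasts more than \<open>k\<close> steps.\<close>

definition increment_tail :: "(nat \<Rightarrow> real) \<Rightarrow> nat \<Rightarrow> real" where
  "increment_tail b k = (\<Sum>n. b (Suc (n + k)))"

text \<open>The quotient of \<open>1 - increment_gf b z\<close> by \<open>1 - z\<close>.\<close>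

definition tail_gf :: "(nat \<Rightarrow> real) \<Rightarrow> complex \<Rightarrow> complex" where
  "tail_gf b z = (\<Sum>k. of_real (increment_tail b k) * z ^ k)"

lemma renewal_generating_function:
  fixes z :: complex
  assumes inc: "increment_sequence b" and ren: "renewal_sequence_of b u" and z: "norm z < 1"
  shows "(1 - increment_gf b z) * (\<Sum>n. of_real (u n) * z ^ n) = 1"
proof -
  define c where "c n = (if n = 0 then 0 else b n)" for n
  have b: "0 \<le> b k" if "k \<ge> 1" for k
    using inc that by (simp add: increment_sequence_def)
  have b1: "b (Suc k) \<le> 1" for k
    using inc b sum_le_suminf[of "\<lambda>k. b (Suc k)" "{k}"]
    by (auto simp: increment_sequence_def sums_iff)
  have c: "norm (complex_of_real (c n)) \<le> 1" for n
    using b[of n] b1[of "n - 1"] by (auto simp: c_def)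
  have smc: "summable (\<lambda>n. norm (of_real (c n) * z ^ n))"
    by (rule powser_bounded_summable[OF c z])
  have smu: "summable (\<lambda>n. norm (of_real (u n) * z ^ n))"
    using renewal_bounded[OF inc ren] by (intro powser_bounded_summable[of _ 1] z) simp
  have cu: "(\<Sum>i\<le>n. c i * u (n - i)) = (if n = 0 then 0 else u n)" for n
  proof (cases "n = 0")
    case False
    have "(\<Sum>i\<le>n. c i * u (n - i)) = (\<Sum>i=1..n. b i * u (n - i))"
      by (rule sum.mono_neutral_cong_right) (auto simp: c_def)
    with False ren show ?thesis by (simp add: renewal_sequence_of_def)
  qed (simp add: c_def)
  have "(\<Sum>n. of_real (c n) * z ^ n) * (\<Sum>n. of_real (u n) * z ^ n)
      = (\<Sum>n. \<Sum>i\<le>n. (of_real (c i) * z ^ i) * (of_real (u (n - i)) * z ^ (n - i)))"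
    by (rule Cauchy_product[OF smc smu])
  also have "\<dots> = (\<Sum>n. of_real (\<Sum>i\<le>n. c i * u (n - i)) * z ^ n)"
    by (intro suminf_cong) (simp add: sum_distrib_right mult.assoc mult.left_commute flip: power_add)
  also have "\<dots> = (\<Sum>n. of_real (u n) * z ^ n) - 1"
  proof -
    have "(\<Sum>n. of_real (u n) * z ^ n) = of_real (u 0) * z ^ 0 + (\<Sum>n. of_real (u (Suc n)) * z ^ Suc n)"
      using suminf_split_head[OF summable_norm_cancel[OF smu]] by simp
    moreover have "summable (\<lambda>n. of_real (if n = 0 then 0 else u n) * z ^ n)"
      using renewal_bounded[OF inc ren]
      by (intro summable_norm_cancel[OF powser_bounded_summable[of _ 1]] z) simp
    note suminf_split_head[OF this]
    ultimately show ?thesis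
      using ren by (simp add: cu renewal_sequence_of_def)
  qed
  also have "(\<Sum>n. of_real (c n) * z ^ n) = increment_gf b z"
    using suminf_split_head[OF summable_norm_cancel[OF smc]] by (simp add: increment_gf_def c_def)
  finally show ?thesis by (simp add: algebra_simps)
qed

text \<open>Increments with an exponential moment: their generating function is holomorphic beyond the
  unit disk.\<close>

locale geometric_increments =
  fixes b :: "nat \<Rightarrow> real" and R L :: real
  assumes inc: "increment_sequence b"
    and R: "R > 1"
    and b_summable: "summable (\<lambda>n. b (Suc n) * R ^ Suc n)"
    and b_bound: "(\<Sum>n. b (Suc n) * R ^ Suc n) \<le> L"
begin

lemma b_nonneg: "n \<ge> 1 \<Longrightarrow> 0 \<le> b n"
  using inc by (simp add: increment_sequence_def)

lemma b_sums: "(\<lambda>n. b (Suc n)) sums 1"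
  using inc by (simp add: increment_sequence_def)

lemma tail_nonneg: "0 \<le> increment_tail b k"
  unfolding increment_tail_def
  using b_sums b_nonneg by (intro suminf_nonneg) (auto simp: sums_iff summable_Suc_iff intro: summable_ignore_initial_segment[where f="\<lambda>n. b (Suc n)"])

lemma tail_0: "increment_tail b 0 = 1"
  using b_sums by (simp add: increment_tail_def sums_iff)

lemma tail_Suc: "increment_tail b (Suc k) = increment_tail b k - b (Suc k)"
proof -
  have "summable (\<lambda>n. b (Suc (n + k)))"
    using b_sums summable_ignore_initial_segment[where f="\<lambda>n. b (Suc n)"] by (auto simp: sums_iff)
  from suminf_split_head[OF this] show ?thesis by (simp add: increment_tail_def)
qed

lemma tail_eq: "increment_tail b n = 1 - (\<Sum>k=1..n. b k)"
  by (induction n) (auto simp: tail_0 tail_Suc)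

lemma tail_bound: "increment_tail b k * R ^ k \<le> L"
proof -
  have sm: "summable (\<lambda>n. b (Suc (n + k)))"
    using b_sums summable_ignore_initial_segment[where f="\<lambda>n. b (Suc n)"] by (auto simp: sums_iff)
  have smR: "summable (\<lambda>n. b (Suc (n + k)) * R ^ Suc (n + k))"
    using b_summable summable_ignore_initial_segment[where f="\<lambda>n. b (Suc n) * R ^ Suc n"] by auto
  have "increment_tail b k * R ^ k = (\<Sum>n. b (Suc (n + k)) * R ^ k)"
    unfolding increment_tail_def by (rule suminf_mult2[OF sm])
  also have "\<dots> \<le> (\<Sum>n. b (Suc (n + k)) * R ^ Suc (n + k))"
    using R b_nonneg
    by (intro suminf_le summable_mult2 sm smR mult_left_mono power_increasing) auto
  also have "\<dots> \<le> (\<Sum>n. b (Suc n) * R ^ Suc n)"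
    using suminf_split_initial_segment[OF b_summable, of k] R b_nonneg
    by (simp add: sum_nonneg)
  finally show ?thesis using b_bound by simp
qed

lemma tail_powser_summable:
  fixes z :: complex
  assumes z: "norm z < R"
  shows "summable (\<lambda>k. norm (of_real (increment_tail b k) * z ^ k))"
proof -
  have "norm (complex_of_real (increment_tail b k * R ^ k)) \<le> L" for k
    unfolding norm_of_real using tail_bound[of k] tail_nonneg[of k] R by simp
  from powser_bounded_summable[of "\<lambda>k. of_real (increment_tail b k * R ^ k)", OF this, of "z / of_real R"]
  show ?thesis
    using z R by (simp add: norm_divide power_divide norm_mult norm_power abs_mult)
qed

lemma b_powser_summable:
  fixes z :: complex
  assumes z: "norm z \<le> R"
  shows "summable (\<lambda>n. norm (of_real (b (Suc n)) * z ^ Suc n))"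
proof (rule summable_comparison_test[OF _ b_summable])
  show "\<exists>N. \<forall>n\<ge>N. norm (norm (of_real (b (Suc n)) * z ^ Suc n)) \<le> b (Suc n) * R ^ Suc n"
  proof (intro exI[of _ 0] allI impI)
    fix n
    have "norm z ^ Suc n \<le> R ^ Suc n" by (intro power_mono z) simp
    then show "norm (norm (of_real (b (Suc n)) * z ^ Suc n)) \<le> b (Suc n) * R ^ Suc n"
      using b_nonneg[of "Suc n"] by (simp add: norm_mult norm_power mult_left_mono del: power_Suc)
  qed
qed

lemma tail_gf_holomorphic: "tail_gf b holomorphic_on ball 0 R"
proof (rule power_series_holomorphic)
  fix z :: complex assume "z \<in> ball 0 R"
  then show "(\<lambda>n. of_real (increment_tail b n) * (z - 0) ^ n) sums tail_gf b z"
    unfolding tail_gf_def using tail_powser_summable[of z]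
    by (auto intro!: summable_sums summable_norm_cancel)
qed

text \<open>Summation by parts. Dividing out the zero at \<open>1\<close> in this explicit form also shows that the
  zero is simple, because the tails are nonnegative and the first one is \<open>1\<close>.\<close>

lemma tail_gf_factor:
  assumes z: "norm z < R"
  shows "1 - increment_gf b z = (1 - z) * tail_gf b z"
proof -
  have smT: "summable (\<lambda>k. of_real (increment_tail b k) * z ^ k)"
    using tail_powser_summable[OF z] by (rule summable_norm_cancel)
  have smb: "summable (\<lambda>n. of_real (b (Suc n)) * z ^ Suc n)"
    by (rule summable_norm_cancel[OF b_powser_summable]) (use z in simp)
  have "(\<Sum>k. of_real (increment_tail b (Suc k)) * z ^ Suc k)
      = (\<Sum>k. z * (of_real (increment_tail b k) * z ^ k) - of_real (b (Suc k)) * z ^ Suc k)"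
    by (intro suminf_cong) (simp add: tail_Suc algebra_simps)
  also have "\<dots> = z * tail_gf b z - increment_gf b z"
    unfolding tail_gf_def increment_gf_def
    using suminf_diff[OF summable_mult[OF smT] smb, of z] suminf_mult[OF smT, of z] by simp
  finally have "tail_gf b z = 1 + (z * tail_gf b z - increment_gf b z)"
    using suminf_split_head[OF smT] by (simp add: tail_gf_def tail_0)
  then show ?thesis by (simp add: algebra_simps)
qed

lemma increment_gf_holomorphic: "increment_gf b holomorphic_on ball 0 R"
proof (rule holomorphic_transform)
  show "(\<lambda>z. 1 - (1 - z) * tail_gf b z) holomorphic_on ball 0 R"
    by (intro holomorphic_intros tail_gf_holomorphic)
qed (use tail_gf_factor in \<open>simp add: algebra_simps\<close>)

lemma tail_gf_1_nonzero: "tail_gf b 1 \<noteq> 0"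
proof -
  have sm: "summable (\<lambda>k. increment_tail b k)"
    using tail_powser_summable[of 1] R tail_nonneg by simp
  have "increment_tail b 0 \<le> (\<Sum>k. increment_tail b k)"
    using sum_le_suminf[OF sm, of "{0}"] tail_nonneg by simp
  then have "(\<Sum>k. increment_tail b k) \<noteq> 0" by (simp add: tail_0)
  moreover have "tail_gf b 1 = of_real (\<Sum>k. increment_tail b k)"
    by (simp add: tail_gf_def suminf_of_real[OF sm])
  ultimately show ?thesis by (simp only: of_real_eq_0_iff not_False_eq_True)
qed

lemma increment_gf_of_real:
  assumes "\<bar>x\<bar> \<le> R"
  shows "increment_gf b (of_real x) = of_real (\<Sum>n. b (Suc n) * x ^ Suc n)"
    and "summable (\<lambda>n. b (Suc n) * x ^ Suc n)"
proof -
  have "summable (\<lambda>n. norm (b (Suc n) * x ^ Suc n))"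
    using b_powser_summable[of "of_real x"] assms by (simp add: norm_mult norm_power abs_mult power_abs)
  then show sm: "summable (\<lambda>n. b (Suc n) * x ^ Suc n)" by (rule summable_norm_cancel)
  show "increment_gf b (of_real x) = of_real (\<Sum>n. b (Suc n) * x ^ Suc n)"
    using suminf_of_real[OF sm, where 'a=complex] by (simp add: increment_gf_def)
qed

text \<open>With \<open>f = 1 / tail_gf b\<close>, holomorphic in the disk of radius \<open>\<rho>\<close>, the renewal identity reads
  \<open>\<Sum> u n z\<^sup>n = f z / (1 - z)\<close>. Subtracting \<open>f 1 / (1 - z)\<close> removes the pole, so the power
  series with coefficients \<open>u n - f 1\<close> converges up to \<open>\<rho>\<close>; at \<open>z = 1\<close> this identifies \<open>f 1\<close> as
  the limit of \<open>u\<close>.\<close>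

lemma renewal_conv_radius:
  assumes ren: "renewal_sequence_of b u"
    and \<rho>: "1 < \<rho>" "\<rho> \<le> R"
    and nz: "\<And>z. norm z < \<rho> \<Longrightarrow> z \<noteq> 1 \<Longrightarrow> increment_gf b z \<noteq> 1"
  shows "conv_radius (\<lambda>n. complex_of_real (u n - lim u)) \<ge> ereal \<rho>"
proof -
  define f where "f z = inverse (tail_gf b z)" for z
  \<comment> \<open>The sum of \<open>(u n - f 1) * z ^ n\<close>; the sign is due to \<open>z - 1\<close> in place of \<open>1 - z\<close>.\<close>
  define g where "g z = - (if z = 1 then deriv f 1 else (f z - f 1) / (z - 1))" for z
  define U where "U z = (\<Sum>n. of_real (u n) * z ^ n)" for z :: complex
  have Tnz: "tail_gf b z \<noteq> 0" if "norm z < \<rho>" for z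
    using nz[OF that] tail_gf_factor[of z] tail_gf_1_nonzero that \<rho> by (cases "z = 1") auto
  have "f holomorphic_on ball 0 \<rho>"
    unfolding f_def using Tnz \<rho> by (intro holomorphic_intros holomorphic_on_subset[OF tail_gf_holomorphic]) auto
  then have "(\<lambda>z. if z = 1 then deriv f 1 else (f z - f 1) / (z - 1)) holomorphic_on ball 0 \<rho>"
    using \<rho> by (intro pole_lemma) auto
  then have g: "g holomorphic_on ball 0 \<rho>"
    unfolding g_def by (rule holomorphic_on_minus)
  have sums: "(\<lambda>n. (of_real (u n) - f 1) * z ^ n) sums g z" if z: "norm z < 1" for z
  proof -
    have smu: "summable (\<lambda>n. of_real (u n) * z ^ n)"
      using renewal_bounded[OF inc ren]
      by (intro summable_norm_cancel[OF powser_bounded_summable[of _ 1]] z) simp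
    have "(1 - z) * (tail_gf b z * U z) = 1"
      using renewal_generating_function[OF inc ren z] tail_gf_factor[of z] z R
      by (simp add: U_def mult.assoc)
    moreover have "tail_gf b z \<noteq> 0" "z \<noteq> 1" using Tnz[of z] z \<rho> by auto
    ultimately have "U z = f z / (1 - z)"
      by (simp add: f_def field_simps)
    then have "g z = U z - f 1 * (1 / (1 - z))"
      using \<open>z \<noteq> 1\<close> by (simp add: g_def divide_simps) (simp add: algebra_simps)
    moreover have "(\<lambda>n. of_real (u n) * z ^ n - f 1 * z ^ n) sums (U z - f 1 * (1 / (1 - z)))"
      unfolding U_def using smu z by (intro sums_diff sums_mult geometric_sums summable_sums) auto
    ultimately show ?thesis by (simp only: left_diff_distrib)
  qed
  let ?F = "Abs_fps (\<lambda>n. of_real (u n) - f 1)"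
  have g_eb: "g holomorphic_on eball 0 (ereal \<rho>)"
    using g by simp
  have "eventually (\<lambda>z. eval_fps ?F z = g z) (nhds 0)"
    using eventually_nhds_in_open[of "ball 0 1" "0::complex", OF open_ball centre_in_ball[THEN iffD2]]
    by (rule eventually_mono) (use sums in \<open>auto simp: eval_fps_def sums_iff\<close>)
  moreover have "fps_conv_radius ?F \<ge> 1"
    unfolding fps_conv_radius_def
    by (rule conv_radius_geI_ex') (use sums in \<open>auto simp: sums_iff\<close>)
  ultimately have "g has_fps_expansion ?F"
    by (auto simp: has_fps_expansion_def intro: less_le_trans[of 0 1])
  then have "?F = fps_expansion g 0"
    by (metis fps_expansion_eqI)
  with conv_radius_fps_expansion[OF g_eb] have "fps_conv_radius ?F \<ge> ereal \<rho>"
    by (simp only:)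
  then have rad: "conv_radius (\<lambda>n. of_real (u n) - f 1) \<ge> ereal \<rho>"
    by (simp add: fps_conv_radius_def)
  have "summable (\<lambda>n. (of_real (u n) - f 1) * 1 ^ n)"
    using rad \<rho> by (intro summable_in_conv_radius less_le_trans[OF _ rad]) simp
  then have "(\<lambda>n. of_real (u n) - f 1) \<longlonglongrightarrow> 0"
    by (simp add: summable_LIMSEQ_zero)
  then have lim: "(\<lambda>n. complex_of_real (u n)) \<longlonglongrightarrow> f 1"
    by (rule LIM_zero_cancel)
  then have "u \<longlonglongrightarrow> Re (f 1)"
    using tendsto_Re[OF lim] by simp
  moreover from this have "(\<lambda>n. complex_of_real (u n)) \<longlonglongrightarrow> of_real (Re (f 1))"
    by (rule tendsto_of_real)
  then have "f 1 = of_real (Re (f 1))"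
    using LIMSEQ_unique[OF lim] by blast
  ultimately show ?thesis
    using rad by (simp add: limI)
qed

end

section \<open>The threshold and the zeros of the renewal denominator\<close>

text \<open>The difference \<open>ln (1 + c * exp x) - \<alpha> * x\<close> is convex. Once it is nonpositive at \<open>s\<close> and
  negative at \<open>T\<close>, it is negative in between. In logarithmic coordinates this works uniformly in
  \<open>\<alpha>\<close>, whereas \<open>r powr \<alpha>\<close> itself is convex or concave according to \<open>\<alpha>\<close>.\<close>

lemma log_affine_exceeds_exponential:
  fixes c \<alpha> s t T :: real
  assumes c: "c \<ge> 0" and st: "s < t" "t \<le> T"
    and s: "\<alpha> * s \<ge> ln (1 + c * exp s)" and T: "\<alpha> * T > ln (1 + c * exp T)"
  shows "\<alpha> * t > ln (1 + c * exp t)"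
proof -
  define f where "f x = ln (1 + c * exp x) - \<alpha> * x" for x :: real
  have pos: "1 + c * exp x > 0" for x :: real
    using c by (intro add_pos_nonneg) auto
  have "convex_on UNIV f"
  proof (rule f''_ge0_imp_convex)
    fix x :: real
    show "DERIV f x :> c * exp x / (1 + c * exp x) - \<alpha>"
      unfolding f_def using pos[of x] by (auto intro!: derivative_eq_intros)
    show "DERIV (\<lambda>x. c * exp x / (1 + c * exp x) - \<alpha>) x :> c * exp x / (1 + c * exp x)\<^sup>2"
    proof (rule DERIV_cong)
      have e: "DERIV (\<lambda>x. c * exp x) x :> c * exp x"
        by (auto intro!: derivative_eq_intros)
      then have "DERIV (\<lambda>x. 1 + c * exp x) x :> 0 + c * exp x"
        by (intro DERIV_add DERIV_const)
      from DERIV_divide[OF e this] pos[of x]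
      show "DERIV (\<lambda>x. c * exp x / (1 + c * exp x) - \<alpha>) x :>
          (c * exp x * (1 + c * exp x) - c * exp x * (0 + c * exp x)) / ((1 + c * exp x) * (1 + c * exp x)) - 0"
        by (intro DERIV_diff DERIV_const) simp
    qed (simp add: power2_eq_square algebra_simps)
    show "c * exp x / (1 + c * exp x)\<^sup>2 \<ge> 0" using c by simp
  qed simp
  define l where "l = (T - t) / (T - s)"
  have "l * (T - s) = T - t" using st by (simp add: l_def)
  then have lt: "t = l * s + (1 - l) * T" by (simp add: algebra_simps)
  have l: "0 \<le> l" "l < 1" using st by (simp_all add: l_def)
  have "f t \<le> l * f s + (1 - l) * f T"
    using convex_onD[OF \<open>convex_on UNIV f\<close>, of "1 - l" s T] l by (simp add: lt)
  also have "\<dots> < 0"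
  proof -
    have "l * f s \<le> 0" using l s by (intro mult_nonneg_nonpos) (auto simp: f_def)
    moreover have "(1 - l) * f T < 0" using l T by (intro mult_pos_neg) (auto simp: f_def)
    ultimately show ?thesis by simp
  qed
  finally show ?thesis by (simp add: f_def)
qed

text \<open>This yields both the uniqueness of the threshold and, contrapositively, the sign of
  \<open>r powr (ln L / ln R) - (1 + 2 * \<beta> * r)\<close> below it. The right end is under control since
  \<open>R powr (ln L / ln R) = L\<close>.\<close>

lemma affine_less_powr_propagates:
  fixes \<beta> R L r r' :: real
  assumes \<beta>: "\<beta> > 0" and R: "R > 1" and L: "L > 1 + 2 * \<beta> * R"
    and r: "1 \<le> r" "r < r'" "r' \<le> R"
    and le: "1 + 2 * \<beta> * r \<le> r powr (ln L / ln R)"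
  shows "1 + 2 * \<beta> * r' < r' powr (ln L / ln R)"
proof -
  let ?\<alpha> = "ln L / ln R"
  have pos: "1 + 2 * \<beta> * x > 0" if "x > 0" for x using \<beta> that by (simp add: add_pos_pos)
  have iff: "1 + 2 * \<beta> * x \<le> x powr ?\<alpha> \<longleftrightarrow> ln (1 + 2 * \<beta> * exp (ln x)) \<le> ?\<alpha> * ln x"
     "1 + 2 * \<beta> * x < x powr ?\<alpha> \<longleftrightarrow> ln (1 + 2 * \<beta> * exp (ln x)) < ?\<alpha> * ln x" if "x > 0" for x
    using pos[OF that] that by (simp_all add: powr_def ln_ge_iff ln_le_cancel_iff[symmetric] ln_less_cancel_iff[symmetric] del: ln_le_cancel_iff ln_less_cancel_iff)
  have "L > 0" using L pos[of R] R by simp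
  then have "R powr ?\<alpha> = L" using R by (simp add: powr_def)
  then have "1 + 2 * \<beta> * R < R powr ?\<alpha>" using L by simp
  then have "ln (1 + 2 * \<beta> * exp (ln R)) < ?\<alpha> * ln R" using iff(2)[of R] R by simp
  moreover have "ln (1 + 2 * \<beta> * exp (ln r)) \<le> ?\<alpha> * ln r" using iff(1)[of r] r le by simp
  ultimately have "ln (1 + 2 * \<beta> * exp (ln r')) < ?\<alpha> * ln r'"
    using log_affine_exceeds_exponential[of "2 * \<beta>" "ln r" "ln r'" "ln R" ?\<alpha>] \<beta> r R by simp
  then show ?thesis using iff(2)[of r'] r by simp
qed

lemma R2_solution_ex1:
  assumes \<beta>: "\<beta> > 0" and R: "R > 1" and L: "L > 1 + 2 * \<beta> * R"
  shows "\<exists>!r. R2_solution \<beta> R L r"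
proof -
  let ?\<alpha> = "ln L / ln R"
  have "L > 0" using L \<beta> R by (smt (verit) mult_pos_pos)
  then have RL: "R powr ?\<alpha> = L" using R by (simp add: powr_def)
  have "\<exists>r\<ge>1. r \<le> R \<and> r powr ?\<alpha> - (1 + 2 * \<beta> * r) = 0"
    by (rule IVT') (use R L \<beta> RL in \<open>auto intro!: continuous_intros\<close>)
  then obtain r where r: "1 \<le> r" "r \<le> R" "1 + 2 * \<beta> * r = r powr ?\<alpha>" by auto
  moreover have "r \<noteq> 1" "r \<noteq> R" using r RL L \<beta> by auto
  ultimately have sol: "R2_solution \<beta> R L r" by (simp add: R2_solution_def)
  moreover have False if "R2_solution \<beta> R L x" "R2_solution \<beta> R L y" "x < y" for x y
    using affine_less_powr_propagates[OF \<beta> R L, of x y] that by (simp add: R2_solution_def)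
  ultimately show ?thesis
    by (intro ex1I[of _ r]) (auto, metis linorder_neqE_linordered_idom)
qed

lemma R2_solution_R2:
  assumes \<beta>: "\<beta> > 0" and R: "R > 1" and L: "L > 1 + 2 * \<beta> * R"
  shows "R2_solution \<beta> R L (R2 \<beta> R L)"
  using theI'[OF R2_solution_ex1[OF \<beta> R L]] L by (simp add: R2_def)

lemma powr_less_affine_below_R2:
  assumes \<beta>: "\<beta> > 0" and R: "R > 1" and L: "L > 1 + 2 * \<beta> * R"
    and r: "1 \<le> r" "r < R2 \<beta> R L"
  shows "r powr (ln L / ln R) < 1 + 2 * \<beta> * r"
proof (rule ccontr)
  have sol: "R2_solution \<beta> R L (R2 \<beta> R L)"
    by (rule R2_solution_R2[OF \<beta> R L])
  assume "\<not> ?thesis"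
  then have "1 + 2 * \<beta> * R2 \<beta> R L < R2 \<beta> R L powr (ln L / ln R)"
    using sol r by (intro affine_less_powr_propagates[OF \<beta> R L, of r]) (auto simp: R2_solution_def)
  with sol show False by (simp add: R2_solution_def)
qed

lemma R2_bounds:
  assumes \<beta>: "\<beta> > 0" and R: "R > 1"
  shows "1 < R2 \<beta> R L" "R2 \<beta> R L \<le> R"
proof -
  have "1 < R2 \<beta> R L \<and> R2 \<beta> R L \<le> R"
  proof (cases "L > 1 + 2 * \<beta> * R")
    case True
    then show ?thesis
      using R2_solution_R2[OF \<beta> R True] by (simp add: R2_solution_def)
  qed (use R in \<open>simp add: R2_def\<close>)
  then show "1 < R2 \<beta> R L" "R2 \<beta> R L \<le> R" by auto
qed

context geometric_increments
begin

definition real_gf :: "real \<Rightarrow> real" where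
  "real_gf x = (\<Sum>n. b (Suc n) * x ^ Suc n)"

lemma real_gf_summable: "\<bar>x\<bar> \<le> R \<Longrightarrow> summable (\<lambda>n. b (Suc n) * x ^ Suc n)"
  by (rule increment_gf_of_real(2))

lemma real_gf_1: "real_gf 1 = 1"
  using b_sums by (simp add: real_gf_def sums_iff)

lemma real_gf_R: "real_gf R \<le> L"
  using b_bound by (simp add: real_gf_def)

lemma real_gf_convex: "convex_on {0..R} real_gf"
proof (rule convex_onI)
  fix t x y :: real assume t: "0 < t" "t < 1" and x: "x \<in> {0..R}" and y: "y \<in> {0..R}"
  let ?z = "(1 - t) *\<^sub>R x + t *\<^sub>R y"
  have z: "?z \<in> {0..R}"
    using convexD[OF convex_real_interval(5) x y, of "1 - t" t] t by simp
  have "real_gf ?z \<le> (\<Sum>n. (1 - t) * (b (Suc n) * x ^ Suc n) + t * (b (Suc n) * y ^ Suc n))"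
    unfolding real_gf_def
  proof (intro suminf_le real_gf_summable summable_add summable_mult)
    fix n
    have "convex_on {0..} (\<lambda>x::real. x ^ Suc n)"
    proof (cases "even (Suc n)")
      case True
      then show ?thesis by (rule convex_on_subset[OF convex_power_even]) auto
    next
      case False
      then show ?thesis by (rule convex_power_odd)
    qed
    from convex_onD[OF this, of t x y]
    have "?z ^ Suc n \<le> (1 - t) * x ^ Suc n + t * y ^ Suc n"
      using t x y by simp
    then have "b (Suc n) * ?z ^ Suc n \<le> b (Suc n) * ((1 - t) * x ^ Suc n + t * y ^ Suc n)"
      by (rule mult_left_mono) (simp add: b_nonneg)
    then show "b (Suc n) * ?z ^ Suc n \<le> (1 - t) * (b (Suc n) * x ^ Suc n) + t * (b (Suc n) * y ^ Suc n)"
      by (simp only: distrib_left mult.left_commute)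
  qed (use x y z in auto)
  also have "\<dots> = (1 - t) * real_gf x + t * real_gf y"
    unfolding real_gf_def using x y
    by (subst suminf_add[symmetric]) (auto intro!: summable_mult real_gf_summable simp: suminf_mult[OF real_gf_summable] simp del: power_Suc)
  finally show "real_gf ?z \<le> (1 - t) * real_gf x + t * real_gf y" .
qed simp

lemma L_ge_1: "1 \<le> L"
proof -
  have "real_gf 1 \<le> real_gf R"
    unfolding real_gf_def using R b_nonneg
    by (intro suminf_le real_gf_summable mult_left_mono power_mono) auto
  with real_gf_1 real_gf_R show ?thesis by simp
qed

text \<open>Hadamard's three-lines bound between the radii \<open>1\<close> and \<open>R\<close>, where the generating function is
  \<open>1\<close> and at most \<open>L\<close>.\<close>

lemma real_gf_le_powr:
  assumes r: "1 \<le> r" "r \<le> R"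
  shows "real_gf r \<le> r powr (ln L / ln R)"
proof -
  define t where "t = ln r / ln R"
  have t: "0 \<le> t" "t \<le> 1" using r R by (simp_all add: t_def)
  have rR: "r = R powr t" using r R by (simp add: t_def powr_def)
  have Lt: "r powr (ln L / ln R) = L powr t"
    using r L_ge_1 by (simp add: powr_def t_def)
  \<comment> \<open>Weighted AM-GM for \<open>1\<close> and \<open>R ^ Suc n / L\<close>, both of which have average at most \<open>1\<close> under \<open>b\<close>.\<close>
  have term_le: "r ^ Suc n \<le> L powr t * (1 - t + t * (R ^ Suc n / L))" for n
  proof -
    have "R ^ Suc n / L > 0" using R L_ge_1 by simp
    then have "(R ^ Suc n / L) powr t \<le> 1 - t + t * (R ^ Suc n / L)"
    proof -
      have "(R ^ Suc n / L) powr t = 1 powr (1 - t) * (R ^ Suc n / L) powr t" by simp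
      also have "\<dots> \<le> (1 - t) * 1 + t * (R ^ Suc n / L)"
        using t \<open>R ^ Suc n / L > 0\<close> by (intro Youngs_inequality_0) auto
      finally show ?thesis by simp
    qed
    then have "L powr t * (R ^ Suc n / L) powr t \<le> L powr t * (1 - t + t * (R ^ Suc n / L))"
      by (rule mult_left_mono) simp
    also have "L powr t * (R ^ Suc n / L) powr t = (R ^ Suc n) powr t"
      using R L_ge_1 by (simp flip: powr_mult)
    also have "\<dots> = r ^ Suc n"
      unfolding rR using R by (simp add: powr_powr powr_realpow[symmetric] mult.commute del: power_Suc)
    finally show ?thesis .
  qed
  have "real_gf r \<le> (\<Sum>n. L powr t * (1 - t) * b (Suc n) + L powr t * t / L * (b (Suc n) * R ^ Suc n))"
    unfolding real_gf_def
  proof (intro suminf_le real_gf_summable summable_add summable_mult)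
    fix n
    have "b (Suc n) * r ^ Suc n \<le> b (Suc n) * (L powr t * (1 - t + t * (R ^ Suc n / L)))"
      by (intro mult_left_mono term_le) (simp add: b_nonneg)
    also have "\<dots> = L powr t * (1 - t) * b (Suc n) + L powr t * t / L * (b (Suc n) * R ^ Suc n)"
      by (simp add: field_simps)
    finally show "b (Suc n) * r ^ Suc n \<le> L powr t * (1 - t) * b (Suc n) + L powr t * t / L * (b (Suc n) * R ^ Suc n)" .
  qed (use r b_sums b_summable in \<open>auto simp: sums_iff\<close>)
  also have "\<dots> = (\<Sum>n. L powr t * (1 - t) * b (Suc n)) + (\<Sum>n. L powr t * t / L * (b (Suc n) * R ^ Suc n))"
    by (intro suminf_add[symmetric] summable_mult sums_summable[OF b_sums] b_summable)
  also have "\<dots> = L powr t * (1 - t) * 1 + L powr t * t / L * real_gf R"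
    by (simp only: suminf_mult[OF sums_summable[OF b_sums]] suminf_mult[OF b_summable]
        sums_unique[OF b_sums, symmetric] real_gf_def)
  also have "\<dots> \<le> L powr t * (1 - t) * 1 + L powr t * t / L * L"
    using t L_ge_1 by (intro add_left_mono mult_left_mono real_gf_R) auto
  also have "\<dots> = L powr t" using L_ge_1 by (simp add: algebra_simps)
  finally show ?thesis unfolding Lt .
qed

text \<open>When \<open>L \<le> 1 + 2 * \<beta> * R\<close> the three-lines bound is not what helps: there plain convexity suffices, as
  the inequality is strict at \<open>1\<close> and holds weakly at \<open>R\<close>.\<close>

lemma real_gf_less_affine_below_R2:
  assumes \<beta>: "\<beta> > 0" and r: "1 \<le> r" "r < R2 \<beta> R L"
  shows "real_gf r < 1 + 2 * \<beta> * r"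
proof (cases "L > 1 + 2 * \<beta> * R")
  case True
  have "real_gf r \<le> r powr (ln L / ln R)"
    using r R2_bounds[OF \<beta> R, of L] by (intro real_gf_le_powr) auto
  also have "\<dots> < 1 + 2 * \<beta> * r"
    by (rule powr_less_affine_below_R2[OF \<beta> R True r])
  finally show ?thesis .
next
  case False
  then have rR: "r < R" using r by (simp add: R2_def)
  define l where "l = (R - r) / (R - 1)"
  have "l * (R - 1) = R - r" using R by (simp add: l_def)
  then have lr: "r = l * 1 + (1 - l) * R" by (simp add: algebra_simps)
  have l: "0 < l" "l \<le> 1" using r rR R by (simp_all add: l_def)
  have "real_gf r \<le> l * real_gf 1 + (1 - l) * real_gf R"
    using convex_onD[OF real_gf_convex, of "1 - l" 1 R] l R by (simp add: lr)
  also have "\<dots> \<le> l * 1 + (1 - l) * (1 + 2 * \<beta> * R)"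
    using l real_gf_R False real_gf_1 by (intro add_mono mult_left_mono) auto
  also have "\<dots> < l * (1 + 2 * \<beta> * 1) + (1 - l) * (1 + 2 * \<beta> * R)"
    using l \<beta> by (intro add_strict_right_mono mult_strict_left_mono) auto
  also have "\<dots> = 1 + 2 * \<beta> * (l * 1 + (1 - l) * R)" by (simp add: algebra_simps)
  also have "\<dots> = 1 + 2 * \<beta> * r" using lr by simp
  finally show ?thesis .
qed

lemma real_gf_strict_mono:
  assumes "b 1 > 0" "0 \<le> x" "x < y" "y \<le> R"
  shows "real_gf x < real_gf y"
proof -
  have "real_gf y - real_gf x = (\<Sum>n. b (Suc n) * y ^ Suc n - b (Suc n) * x ^ Suc n)"
    unfolding real_gf_def using assms by (intro suminf_diff real_gf_summable) auto
  also have "\<dots> > 0"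
  proof (rule suminf_pos2[where i=0])
    show "summable (\<lambda>n. b (Suc n) * y ^ Suc n - b (Suc n) * x ^ Suc n)"
      using assms by (intro summable_diff real_gf_summable) auto
    show "0 \<le> b (Suc n) * y ^ Suc n - b (Suc n) * x ^ Suc n" for n
      using assms by (simp add: mult_left_mono power_mono b_nonneg del: power_Suc)
  qed (use assms in auto)
  finally show ?thesis by simp
qed

text \<open>The odd terms change sign, and \<open>b 1 * r\<close> is one of them.\<close>

lemma real_gf_minus_le:
  assumes r: "0 \<le> r" "r \<le> R"
  shows "real_gf (- r) \<le> real_gf r - 2 * b 1 * r"
proof -
  have sm: "summable (\<lambda>n. b (Suc n) * r ^ Suc n - b (Suc n) * (- r) ^ Suc n)"
    using r by (intro summable_diff real_gf_summable) auto
  have "(\<Sum>n\<in>{0}. b (Suc n) * r ^ Suc n - b (Suc n) * (- r) ^ Suc n) \<le> (\<Sum>n. b (Suc n) * r ^ Suc n - b (Suc n) * (- r) ^ Suc n)"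
  proof (rule sum_le_suminf[OF sm])
    fix n
    have "(- r) ^ Suc n \<le> r ^ Suc n"
      using abs_ge_self[of "(- r) ^ Suc n"] r by (simp add: power_abs abs_mult)
    then show "0 \<le> b (Suc n) * r ^ Suc n - b (Suc n) * (- r) ^ Suc n"
      by (simp add: mult_left_mono b_nonneg del: power_Suc)
  qed auto
  also have "\<dots> = real_gf r - real_gf (- r)"
    unfolding real_gf_def using r by (intro suminf_diff[symmetric] real_gf_summable) auto
  finally show ?thesis by (simp add: algebra_simps)
qed

text \<open>Here \<open>M\<close> is the continuation of the series of \<open>u (k + 1)\<close> to the cut plane that reversibility
  provides. Off the cuts \<open>(1 - increment_gf b z) * (1 + z * M z) = 1\<close> persists by analytic
  continuation, so the first factor cannot vanish; on the cuts \<open>z\<close> is real and the estimates for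
  \<open>real_gf\<close> apply.\<close>

lemma increment_gf_neq_1_below_R2:
  assumes ren: "renewal_sequence_of b u" and \<beta>: "\<beta> > 0" "b 1 \<ge> \<beta>"
    and M: "M holomorphic_on {z. Im z = 0 \<longrightarrow> \<bar>Re z\<bar> < 1}"
    and M_eq: "\<And>z. norm z < 1 \<Longrightarrow> M z = (\<Sum>k. of_real (u (Suc k)) * z ^ k)"
    and z: "norm z < R2 \<beta> R L" "z \<noteq> 1"
  shows "increment_gf b z \<noteq> 1"
proof (cases "Im z = 0 \<longrightarrow> \<bar>Re z\<bar> < 1")
  case True
  let ?D = "{z. Im z = 0 \<longrightarrow> \<bar>Re z\<bar> < 1} \<inter> ball 0 R"
  have op: "open ?D"
  proof -
    have "{z. Im z = 0 \<longrightarrow> \<bar>Re z\<bar> < 1} = - ({z. Im z = 0} \<inter> {z. 1 \<le> \<bar>Re z\<bar>})" by auto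
    moreover have "closed ({z. Im z = 0} \<inter> {z. 1 \<le> \<bar>Re z\<bar>})"
      by (intro closed_Int closed_Collect_eq closed_Collect_le continuous_intros)
    ultimately have "open {z. Im z = 0 \<longrightarrow> \<bar>Re z\<bar> < 1}" by (simp only: open_Compl)
    then show ?thesis by (intro open_Int) auto
  qed
  have "starlike ?D"
    unfolding starlike_def
  proof (rule bexI[of _ 0], rule ballI, rule subsetI)
    fix x y assume x: "x \<in> ?D" and y: "y \<in> closed_segment 0 x"
    then obtain t where t: "0 \<le> t" "t \<le> 1" "y = t *\<^sub>R x"
      by (auto simp: in_segment)
    have "norm y \<le> norm x" using t by (simp add: mult_left_le_one_le)
    moreover have "\<bar>Re y\<bar> < 1" if "Im y = 0"
    proof (cases "t = 0")
      case False
      with that t have "Im x = 0" by simp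
      with x have "\<bar>Re x\<bar> < 1" by simp
      moreover have "\<bar>Re y\<bar> \<le> \<bar>Re x\<bar>" using t by (simp add: abs_mult mult_left_le_one_le)
      ultimately show ?thesis by simp
    qed (use t in simp)
    ultimately show "y \<in> ?D" using x by simp
  qed (use R in simp)
  then have con: "connected ?D" by (rule starlike_imp_connected)
  have "(1 - increment_gf b z) * (1 + z * M z) = 1"
  proof (rule analytic_continuation_open[of "ball 0 1" ?D "\<lambda>z. (1 - increment_gf b z) * (1 + z * M z)" "\<lambda>_. 1" z])
    show "ball 0 1 \<subseteq> ?D"
      using R by (auto intro: le_less_trans[OF abs_Re_le_cmod])
    show "(\<lambda>z. (1 - increment_gf b z) * (1 + z * M z)) holomorphic_on ?D"
      by (intro holomorphic_intros holomorphic_on_subset[OF increment_gf_holomorphic] holomorphic_on_subset[OF M]) auto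
    show "z \<in> ?D" using True z R2_bounds[OF \<beta>(1) R, of L] by simp
    fix y :: complex assume "y \<in> ball 0 1"
    then have y: "norm y < 1" by simp
    have sm: "summable (\<lambda>n. of_real (u n) * y ^ n)"
      and sm': "summable (\<lambda>n. of_real (u (Suc n)) * y ^ n)"
      using renewal_bounded[OF inc ren]
      by (auto intro!: summable_norm_cancel[OF powser_bounded_summable[of _ 1]] y)
    have "(\<Sum>n. of_real (u n) * y ^ n) = 1 + y * M y"
      using suminf_split_head[OF sm] ren suminf_mult[OF sm', of y]
      by (simp add: M_eq[OF y] renewal_sequence_of_def algebra_simps)
    then show "(1 - increment_gf b y) * (1 + y * M y) = 1"
      using renewal_generating_function[OF inc ren y] by simp
  qed (auto intro: op con holomorphic_intros)
  then show ?thesis by auto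
next
  case False
  define x where "x = Re z"
  have zx: "z = of_real x" and x1: "\<bar>x\<bar> \<ge> 1"
    using False by (auto simp: x_def complex_eq_iff)
  have xR2: "\<bar>x\<bar> < R2 \<beta> R L" and xR: "\<bar>x\<bar> < R"
    using z R2_bounds[OF \<beta>(1) R, of L] by (auto simp: zx)
  have "real_gf x \<noteq> 1"
  proof (cases "x > 0")
    case True
    with x1 z have "1 < x" by (auto simp: zx)
    then have "real_gf 1 < real_gf x" using \<beta> xR by (intro real_gf_strict_mono) auto
    then show ?thesis by (simp add: real_gf_1)
  next
    case False
    have "real_gf x \<le> real_gf (- x) - 2 * b 1 * (- x)"
      using real_gf_minus_le[of "- x"] False xR by simp
    also have "\<dots> \<le> real_gf (- x) - 2 * \<beta> * (- x)"
      using \<beta> False by (simp add: mult_right_mono_neg)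
    also have "\<dots> < 1"
      using real_gf_less_affine_below_R2[OF \<beta>(1), of "- x"] False x1 xR2 by simp
    finally show ?thesis by simp
  qed
  then show ?thesis
    using increment_gf_of_real(1)[of x] xR by (simp add: zx real_gf_def)
qed

end

section \<open>The law of the chain at a fixed time\<close>

text \<open>The law of the state at time \<open>n\<close>.\<close>

primrec step_law :: "('a \<Rightarrow> 'a measure) \<Rightarrow> 'a measure \<Rightarrow> nat \<Rightarrow> 'a measure" where
  "step_law P \<nu> 0 = \<nu>"
| "step_law P \<nu> (Suc n) = step_law P \<nu> n \<bind> P"

lemma step_law_in_prob_algebra:
  assumes "P \<in> S \<rightarrow>\<^sub>M prob_algebra S" "\<nu> \<in> space (prob_algebra S)"
  shows "step_law P \<nu> n \<in> space (prob_algebra S)"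
proof (induction n)
  case (Suc n)
  with assms show ?case
    using prob_space_bind'[OF Suc assms(1)] sets_bind'[OF Suc assms(1)]
    by (simp add: space_prob_algebra)
qed (use assms in simp)

lemma Ionescu_Tulcea_chain_step:
  assumes P: "P \<in> S \<rightarrow>\<^sub>M prob_algebra S" and \<nu>: "\<nu> \<in> space (prob_algebra S)"
  shows "Ionescu_Tulcea (chain_step P \<nu>) (\<lambda>_. S)"
proof (rule Ionescu_Tulcea.intro)
  fix i :: nat
  show "chain_step P \<nu> i \<in> PiM {0..<i} (\<lambda>_. S) \<rightarrow>\<^sub>M subprob_algebra S"
  proof (cases i)
    case 0
    have "\<nu> \<in> space (subprob_algebra S)"
      using \<nu> by (auto simp: space_prob_algebra space_subprob_algebra prob_space_imp_subprob_space)
    then show ?thesis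
      by (simp add: 0 chain_step_def[abs_def])
  next
    case (Suc n)
    have "(\<lambda>\<omega>. P (\<omega> n)) \<in> PiM {0..<Suc n} (\<lambda>_. S) \<rightarrow>\<^sub>M subprob_algebra S"
      by (rule measurable_compose[OF _ measurable_prob_algebraD[OF P]])
         (simp add: measurable_component_singleton)
    then show ?thesis
      by (simp add: Suc chain_step_def[abs_def])
  qed
next
  fix i :: nat and x assume x: "x \<in> space (PiM {0..<i} (\<lambda>_. S))"
  show "prob_space (chain_step P \<nu> i x)"
  proof (cases i)
    case 0
    with \<nu> show ?thesis by (simp add: chain_step_def space_prob_algebra)
  next
    case (Suc n)
    with x have "x n \<in> space S" by (auto simp: space_PiM PiE_iff)
    then have "P (x n) \<in> space (prob_algebra S)" by (rule measurable_space[OF P])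
    with Suc show ?thesis by (simp add: chain_step_def space_prob_algebra)
  qed
qed

text \<open>\<open>C 0 (Suc n)\<close> is the joint law of the coordinates \<open>0..n\<close>; only the latest of them matters for the
  next step, which is the Markov property.\<close>

lemma nn_integral_chain_coordinate:
  assumes P: "P \<in> S \<rightarrow>\<^sub>M prob_algebra S" and \<nu>: "\<nu> \<in> space (prob_algebra S)"
    and f: "f \<in> borel_measurable S"
  shows "(\<integral>\<^sup>+\<omega>. f (\<omega> n) \<partial>Ionescu_Tulcea.C (chain_step P \<nu>) (\<lambda>_. S) 0 (Suc n) (\<lambda>_. undefined))
       = (\<integral>\<^sup>+x. f x \<partial>step_law P \<nu> n)"
  using f
proof (induction n arbitrary: f)
  interpret IT: Ionescu_Tulcea "chain_step P \<nu>" "\<lambda>_. S"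
    using P \<nu> by (rule Ionescu_Tulcea_chain_step)
  have u: "(\<lambda>_. undefined) \<in> space (PiM {0..<0::nat} (\<lambda>_. S))" by (simp add: space_PiM)
  {
    case 0
    have [measurable]: "f \<in> borel_measurable S" by fact
    have "IT.C 0 (Suc 0) (\<lambda>_. undefined) = IT.eP 0 (\<lambda>_. undefined)"
      using bind_return[OF IT.measurable_eP[of 0] u] by simp
    also have "(\<integral>\<^sup>+\<omega>. f (\<omega> 0) \<partial>\<dots>) = (\<integral>\<^sup>+x. f x \<partial>chain_step P \<nu> 0 (\<lambda>_. undefined))"
      by (subst IT.nn_integral_eP[OF u]) simp_all
    also have "\<dots> = (\<integral>\<^sup>+x. f x \<partial>step_law P \<nu> 0)"
      by (simp add: chain_step_def)
    finally show ?case .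
  next
    case (Suc n)
    have f[measurable]: "f \<in> borel_measurable S" by fact
    have PS: "P \<in> S \<rightarrow>\<^sub>M subprob_algebra S" by (rule measurable_prob_algebraD[OF P])
    have g: "(\<lambda>x. \<integral>\<^sup>+y. f y \<partial>P x) \<in> borel_measurable S"
      using PS by measurable
    have "(\<integral>\<^sup>+\<omega>. f (\<omega> (Suc n)) \<partial>IT.C 0 (Suc (Suc n)) (\<lambda>_. undefined))
        = (\<integral>\<^sup>+\<omega>. \<integral>\<^sup>+\<omega>'. f (\<omega>' (Suc n)) \<partial>IT.eP (Suc n) \<omega> \<partial>IT.C 0 (Suc n) (\<lambda>_. undefined))"
      unfolding IT.C.simps(2)[of 0 "Suc n"] add_0
      by (rule nn_integral_bind[where B="PiM {0..<Suc (Suc n)} (\<lambda>_. S)"])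
         (measurable, use IT.measurable_eP[of "Suc n"] in \<open>simp del: IT.C.simps add: measurable_cong_sets[OF IT.sets_C[OF u] refl]\<close>)
    also have "\<dots> = (\<integral>\<^sup>+\<omega>. \<integral>\<^sup>+y. f y \<partial>P (\<omega> n) \<partial>IT.C 0 (Suc n) (\<lambda>_. undefined))"
    proof (rule nn_integral_cong)
      fix \<omega> assume "\<omega> \<in> space (IT.C 0 (Suc n) (\<lambda>_. undefined))"
      then have w: "\<omega> \<in> space (PiM {0..<Suc n} (\<lambda>_. S))"
        using IT.space_C[OF u, of "Suc n"] by simp
      show "(\<integral>\<^sup>+\<omega>'. f (\<omega>' (Suc n)) \<partial>IT.eP (Suc n) \<omega>) = (\<integral>\<^sup>+y. f y \<partial>P (\<omega> n))"
        by (subst IT.nn_integral_eP[OF w]) (simp_all add: chain_step_def)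
    qed
    also have "\<dots> = (\<integral>\<^sup>+x. \<integral>\<^sup>+y. f y \<partial>P x \<partial>step_law P \<nu> n)"
      by (rule Suc.IH[OF g])
    also have "\<dots> = (\<integral>\<^sup>+x. f x \<partial>step_law P \<nu> (Suc n))"
      using step_law_in_prob_algebra[OF P \<nu>, of n] PS
      by (simp add: nn_integral_bind[OF f] space_prob_algebra cong: measurable_cong_sets)
    finally show ?case .
  }
qed

lemma measure_chain_law:
  assumes P: "P \<in> S \<rightarrow>\<^sub>M prob_algebra S" and \<nu>: "\<nu> \<in> space (prob_algebra S)" and A: "A \<in> sets S"
  shows "measure (chain_law S P \<nu>) {\<omega> \<in> space (chain_law S P \<nu>). \<omega> n \<in> A}
       = measure (step_law P \<nu> n) A"
proof -
  interpret IT: Ionescu_Tulcea "chain_step P \<nu>" "\<lambda>_. S"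
    using P \<nu> by (rule Ionescu_Tulcea_chain_step)
  let ?J = "{0..<Suc n}" and ?u = "\<lambda>_. undefined :: 'a"
  let ?X = "{\<omega> \<in> space (PiM ?J (\<lambda>_. S)). \<omega> n \<in> A}"
  have u: "?u \<in> space (PiM {0..<0::nat} (\<lambda>_. S))" by (simp add: space_PiM)
  have X: "?X \<in> sets (PiM ?J (\<lambda>_. S))" using A by measurable
  have sp: "space (chain_law S P \<nu>) = space (PiM UNIV (\<lambda>_. S))"
    unfolding chain_law_def by (rule sets_eq_imp_space_eq[OF IT.PF.sets_lim])
  have "{\<omega> \<in> space (chain_law S P \<nu>). \<omega> n \<in> A} = IT.PF.emb UNIV ?J ?X"
    unfolding sp by (auto simp: prod_emb_def space_PiM PiE_iff)
  then have "emeasure (chain_law S P \<nu>) {\<omega> \<in> space (chain_law S P \<nu>). \<omega> n \<in> A} = emeasure (IT.CI ?J) ?X"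
    using IT.lim[OF _ X] by (simp add: chain_law_def)
  also have "\<dots> = emeasure (IT.C 0 (Suc n) ?u) (IT.PF.emb ?J ?J ?X)"
    by (rule IT.emeasure_CI[OF _ X]) simp
  also have "IT.PF.emb ?J ?J ?X = ?X"
    by (intro prod_emb_id) (auto simp: space_PiM)
  also have "emeasure (IT.C 0 (Suc n) ?u) ?X = (\<integral>\<^sup>+\<omega>. indicator ?X \<omega> \<partial>IT.C 0 (Suc n) ?u)"
    using X IT.sets_C[OF u, of "Suc n"] by simp
  also have "\<dots> = (\<integral>\<^sup>+\<omega>. indicator A (\<omega> n) \<partial>IT.C 0 (Suc n) ?u)"
    using IT.space_C[OF u, of "Suc n"]
    by (intro nn_integral_cong) (auto simp: indicator_def simp del: IT.C.simps)
  also have "\<dots> = (\<integral>\<^sup>+x. indicator A x \<partial>step_law P \<nu> n)"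
    by (rule nn_integral_chain_coordinate[OF P \<nu>]) (use A in simp)
  also have "\<dots> = emeasure (step_law P \<nu> n) A"
    using A step_law_in_prob_algebra[OF P \<nu>, of n] by (simp add: space_prob_algebra)
  finally show ?thesis by (simp add: measure_def)
qed

section \<open>Bounded measurable functions and transition operators\<close>

text \<open>All functions below are of this kind: integrable for every probability measure on \<open>S\<close>, and closed
  under the operations used. Identities can then be stated pointwise on the space of \<open>S\<close> and do not
  have to pass through classes modulo null sets.\<close>

definition bounded_measurable :: "'a measure \<Rightarrow> ('a \<Rightarrow> real) set" where
  "bounded_measurable S = {f \<in> borel_measurable S. \<exists>B. \<forall>x\<in>space S. \<bar>f x\<bar> \<le> B}"

lemma bounded_measurableI:
  "f \<in> borel_measurable S \<Longrightarrow> (\<And>x. x \<in> space S \<Longrightarrow> \<bar>f x\<bar> \<le> B) \<Longrightarrow> f \<in> bounded_measurable S"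
  by (auto simp: bounded_measurable_def)

lemma bounded_measurableE:
  assumes "f \<in> bounded_measurable S"
  obtains B where "f \<in> borel_measurable S" "\<And>x. x \<in> space S \<Longrightarrow> \<bar>f x\<bar> \<le> B" "0 \<le> B"
proof -
  from assms obtain B where B: "f \<in> borel_measurable S" "\<forall>x\<in>space S. \<bar>f x\<bar> \<le> B"
    by (auto simp: bounded_measurable_def)
  show thesis
    by (rule that[of "max B 0"]) (use B in \<open>auto simp: le_max_iff_disj\<close>)
qed

lemma bounded_measurable_const [simp, intro]: "(\<lambda>_. c) \<in> bounded_measurable S"
  by (rule bounded_measurableI[where B="\<bar>c\<bar>"]) auto

lemma bounded_measurable_indicator [simp, intro]: "A \<in> sets S \<Longrightarrow> indicator A \<in> bounded_measurable S"
  by (rule bounded_measurableI[where B=1]) (auto simp: indicator_def)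

lemma bounded_measurable_add [intro]:
  assumes "f \<in> bounded_measurable S" "g \<in> bounded_measurable S"
  shows "(\<lambda>x. f x + g x) \<in> bounded_measurable S"
proof -
  obtain A B where f: "f \<in> borel_measurable S" "\<And>x. x \<in> space S \<Longrightarrow> \<bar>f x\<bar> \<le> A"
    and g: "g \<in> borel_measurable S" "\<And>x. x \<in> space S \<Longrightarrow> \<bar>g x\<bar> \<le> B"
    using assms by (metis bounded_measurableE)
  show ?thesis
    using f(1) g(1) by (rule bounded_measurableI[OF borel_measurable_add, where B="A + B"])
      (rule order_trans[OF abs_triangle_ineq], intro add_mono f g)
qed

lemma bounded_measurable_mult [intro]:
  assumes "f \<in> bounded_measurable S" "g \<in> bounded_measurable S"
  shows "(\<lambda>x. f x * g x) \<in> bounded_measurable S"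
proof -
  obtain A B where f: "f \<in> borel_measurable S" "\<And>x. x \<in> space S \<Longrightarrow> \<bar>f x\<bar> \<le> A" "0 \<le> A"
    and g: "g \<in> borel_measurable S" "\<And>x. x \<in> space S \<Longrightarrow> \<bar>g x\<bar> \<le> B" "0 \<le> B"
    using assms by (metis bounded_measurableE)
  show ?thesis
    using f(1) g(1) by (rule bounded_measurableI[OF borel_measurable_times, where B="A * B"])
      (simp add: abs_mult f g mult_mono)
qed

lemma bounded_measurable_cmult [intro]:
  "f \<in> bounded_measurable S \<Longrightarrow> (\<lambda>x. c * f x) \<in> bounded_measurable S"
  by (intro bounded_measurable_mult bounded_measurable_const)

lemma bounded_measurable_diff [intro]:
  assumes "f \<in> bounded_measurable S" "g \<in> bounded_measurable S"
  shows "(\<lambda>x. f x - g x) \<in> bounded_measurable S"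
  using bounded_measurable_add[OF assms(1) bounded_measurable_cmult[OF assms(2), of "-1"]] by simp

lemma bounded_measurable_power2 [intro]:
  "f \<in> bounded_measurable S \<Longrightarrow> (\<lambda>x. (f x)\<^sup>2) \<in> bounded_measurable S"
  unfolding power2_eq_square by (rule bounded_measurable_mult)

lemma integrable_bounded_measurable:
  assumes "\<mu> \<in> space (prob_algebra S)" "f \<in> bounded_measurable S"
  shows "integrable \<mu> f"
proof -
  interpret prob_space \<mu> using assms(1) by (simp add: space_prob_algebra)
  have \<mu>[measurable_cong, simp]: "sets \<mu> = sets S" "space \<mu> = space S"
    using assms(1) by (auto simp: space_prob_algebra dest: sets_eq_imp_space_eq)
  obtain B where [measurable]: "f \<in> borel_measurable S" and B: "\<And>x. x \<in> space S \<Longrightarrow> \<bar>f x\<bar> \<le> B"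
    using assms(2) by (metis bounded_measurableE)
  show ?thesis
    by (rule integrable_const_bound[where B=B]) (auto simp: B intro!: AE_I2)
qed

lemma kernel_integral_bounded_measurable:
  assumes K: "K \<in> M \<rightarrow>\<^sub>M prob_algebra N" and f: "f \<in> bounded_measurable N"
  shows "(\<lambda>x. \<integral>y. f y \<partial>K x) \<in> bounded_measurable M"
proof -
  obtain B where [measurable]: "f \<in> borel_measurable N" and B: "\<And>y. y \<in> space N \<Longrightarrow> \<bar>f y\<bar> \<le> B" "0 \<le> B"
    using f by (metis bounded_measurableE)
  have [measurable]: "K \<in> M \<rightarrow>\<^sub>M subprob_algebra N" by (rule measurable_prob_algebraD[OF K])
  show ?thesis
  proof (rule bounded_measurableI)
    show "(\<lambda>x. \<integral>y. f y \<partial>K x) \<in> borel_measurable M" by measurable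
    fix x assume x: "x \<in> space M"
    have Kx: "K x \<in> space (prob_algebra N)" by (rule measurable_space[OF K x])
    then have sK: "space (K x) = space N"
      by (auto simp: space_prob_algebra dest: sets_eq_imp_space_eq)
    interpret prob_space "K x" using Kx by (simp add: space_prob_algebra)
    have "\<bar>\<integral>y. f y \<partial>K x\<bar> \<le> (\<integral>y. \<bar>f y\<bar> \<partial>K x)" by (rule integral_abs_bound)
    also have "\<dots> \<le> (\<integral>y. B \<partial>K x)"
      using B sK integrable_bounded_measurable[OF Kx f] by (intro integral_mono) auto
    finally show "\<bar>\<integral>y. f y \<partial>K x\<bar> \<le> B" by (simp add: prob_space)
  qed
qed

text \<open>For nonnegative integrands this is the definition of a mixture; a bounded integrand is made
  nonnegative by adding a bound of it, which both sides absorb in the same way because all the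
  measures have mass one.\<close>

lemma integral_bind_bounded:
  assumes \<mu>: "\<mu> \<in> space (prob_algebra M)" and K: "K \<in> M \<rightarrow>\<^sub>M prob_algebra N"
    and f: "f \<in> bounded_measurable N"
  shows "(\<integral>y. f y \<partial>(\<mu> \<bind> K)) = (\<integral>x. \<integral>y. f y \<partial>K x \<partial>\<mu>)"
proof -
  have s\<mu>: "sets \<mu> = sets M" "space \<mu> = space M"
    using \<mu> by (auto simp: space_prob_algebra dest: sets_eq_imp_space_eq)
  have Kx: "K x \<in> space (prob_algebra N)" if "x \<in> space M" for x
    using measurable_space[OF K that] .
  then have sK: "space (K x) = space N" if "x \<in> space M" for x
    using that by (auto simp: space_prob_algebra dest: sets_eq_imp_space_eq)
  have bind: "\<mu> \<bind> K \<in> space (prob_algebra N)"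
    using prob_space_bind'[OF \<mu> K] sets_bind'[OF \<mu> K] by (simp add: space_prob_algebra)
  then have sb: "space (\<mu> \<bind> K) = space N"
    by (auto simp: space_prob_algebra dest: sets_eq_imp_space_eq)
  have KS: "K \<in> M \<rightarrow>\<^sub>M subprob_algebra N" by (rule measurable_prob_algebraD[OF K])
  have nonneg_case: "(\<integral>y. f y \<partial>(\<mu> \<bind> K)) = (\<integral>x. \<integral>y. f y \<partial>K x \<partial>\<mu>)"
    if f: "f \<in> bounded_measurable N" and nn: "\<And>y. y \<in> space N \<Longrightarrow> 0 \<le> f y" for f
  proof -
    let ?g = "\<lambda>x. \<integral>y. f y \<partial>K x"
    have g: "?g \<in> bounded_measurable M" by (rule kernel_integral_bounded_measurable[OF K f])
    have fm: "f \<in> borel_measurable N" using f by (metis bounded_measurableE)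
    have "ennreal (\<integral>y. f y \<partial>(\<mu> \<bind> K)) = (\<integral>\<^sup>+y. f y \<partial>(\<mu> \<bind> K))"
      using integrable_bounded_measurable[OF bind f] nn sb
      by (intro nn_integral_eq_integral[symmetric] AE_I2) auto
    also have "\<dots> = (\<integral>\<^sup>+x. \<integral>\<^sup>+y. f y \<partial>K x \<partial>\<mu>)"
      by (rule nn_integral_bind[where B=N]) (use fm KS s\<mu> in \<open>auto cong: measurable_cong_sets\<close>)
    also have "\<dots> = (\<integral>\<^sup>+x. ennreal (?g x) \<partial>\<mu>)"
    proof (rule nn_integral_cong)
      fix x assume "x \<in> space \<mu>"
      then have x: "x \<in> space M" by (simp add: s\<mu>)
      show "(\<integral>\<^sup>+y. f y \<partial>K x) = ennreal (?g x)"
        using integrable_bounded_measurable[OF Kx[OF x] f] nn sK[OF x]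
        by (intro nn_integral_eq_integral AE_I2) auto
    qed
    also have "\<dots> = ennreal (\<integral>x. ?g x \<partial>\<mu>)"
      using integrable_bounded_measurable[OF \<mu> g] nn sK
      by (intro nn_integral_eq_integral AE_I2) (auto simp: s\<mu> intro!: integral_nonneg_AE AE_I2)
    finally show ?thesis
      using nn sK sb s\<mu> by (subst (asm) ennreal_inj) (auto intro!: integral_nonneg_AE AE_I2)
  qed
  obtain B where B: "\<And>y. y \<in> space N \<Longrightarrow> \<bar>f y\<bar> \<le> B" using f by (metis bounded_measurableE)
  have nonneg: "0 \<le> f y + B" if "y \<in> space N" for y
    using B[OF that] by linarith
  have fB: "(\<lambda>y. f y + B) \<in> bounded_measurable N"
    using f by (intro bounded_measurable_add bounded_measurable_const)
  have shift: "(\<integral>y. f y + B \<partial>\<kappa>) = (\<integral>y. f y \<partial>\<kappa>) + B" if "\<kappa> \<in> space (prob_algebra N)" for \<kappa>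
  proof -
    interpret prob_space \<kappa> using that by (simp add: space_prob_algebra)
    show ?thesis using integrable_bounded_measurable[OF that f] by (simp add: prob_space)
  qed
  interpret \<mu>: prob_space \<mu> using \<mu> by (simp add: space_prob_algebra)
  have "(\<integral>y. f y \<partial>(\<mu> \<bind> K)) + B = (\<integral>x. \<integral>y. f y + B \<partial>K x \<partial>\<mu>)"
    using nonneg_case[OF fB nonneg] shift[OF bind] by simp
  also have "\<dots> = (\<integral>x. (\<integral>y. f y \<partial>K x) + B \<partial>\<mu>)"
    by (rule Bochner_Integration.integral_cong) (simp_all add: s\<mu> shift Kx)
  also have "\<dots> = (\<integral>x. \<integral>y. f y \<partial>K x \<partial>\<mu>) + B"
    using integrable_bounded_measurable[OF \<mu> kernel_integral_bounded_measurable[OF K f]]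
    by (simp add: \<mu>.prob_space)
  finally show ?thesis by simp
qed

lemma integral_square_le:
  assumes \<mu>: "\<mu> \<in> space (prob_algebra S)" and f: "f \<in> bounded_measurable S"
  shows "(\<integral>x. f x \<partial>\<mu>)\<^sup>2 \<le> (\<integral>x. (f x)\<^sup>2 \<partial>\<mu>)"
proof -
  interpret prob_space \<mu> using \<mu> by (simp add: space_prob_algebra)
  have "0 \<le> variance f" by (rule Bochner_Integration.integral_nonneg) simp
  also have "variance f = (\<integral>x. (f x)\<^sup>2 \<partial>\<mu>) - (\<integral>x. f x \<partial>\<mu>)\<^sup>2"
    using integrable_bounded_measurable[OF \<mu>] f by (intro variance_eq) auto
  finally show ?thesis by simp
qed

locale markov_kernel =
  fixes S :: "'a measure" and P :: "'a \<Rightarrow> 'a measure"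
  assumes kernel: "P \<in> S \<rightarrow>\<^sub>M prob_algebra S"
begin

abbreviation "\<T> \<equiv> transition_op P"

lemma P_prob: "x \<in> space S \<Longrightarrow> P x \<in> space (prob_algebra S)"
  by (rule measurable_space[OF kernel])

lemma op_bounded_measurable [intro]:
  "f \<in> bounded_measurable S \<Longrightarrow> \<T> f \<in> bounded_measurable S"
  using kernel_integral_bounded_measurable[OF kernel] by (simp add: transition_op_def[abs_def])

lemma op_iter_bounded_measurable [intro]:
  "f \<in> bounded_measurable S \<Longrightarrow> (\<T> ^^ n) f \<in> bounded_measurable S"
  by (induction n) auto

lemma integral_bind_kernel:
  "\<mu> \<in> space (prob_algebra S) \<Longrightarrow> f \<in> bounded_measurable S \<Longrightarrow>
    (\<integral>y. f y \<partial>(\<mu> \<bind> P)) = (\<integral>x. \<T> f x \<partial>\<mu>)"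
  unfolding transition_op_def by (rule integral_bind_bounded[OF _ kernel])

lemma integral_step_law:
  assumes \<nu>: "\<nu> \<in> space (prob_algebra S)" and f: "f \<in> bounded_measurable S"
  shows "(\<integral>x. f x \<partial>step_law P \<nu> n) = (\<integral>x. (\<T> ^^ n) f x \<partial>\<nu>)"
  using f
proof (induction n arbitrary: f)
  case (Suc n)
  have "(\<integral>x. f x \<partial>step_law P \<nu> (Suc n)) = (\<integral>x. \<T> f x \<partial>step_law P \<nu> n)"
    using integral_bind_kernel[OF step_law_in_prob_algebra[OF kernel \<nu>] Suc.prems] by simp
  also have "\<dots> = (\<integral>x. (\<T> ^^ n) (\<T> f) x \<partial>\<nu>)"
    by (rule Suc.IH) (use Suc.prems in auto)
  finally show ?case by (simp only: funpow_Suc_right o_apply)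
qed simp

lemma op_cong: "x \<in> space S \<Longrightarrow> (\<And>y. y \<in> space S \<Longrightarrow> f y = g y) \<Longrightarrow> \<T> f x = \<T> g x"
  unfolding transition_op_def
  using P_prob[of x] by (intro Bochner_Integration.integral_cong) (auto simp: space_prob_algebra dest: sets_eq_imp_space_eq)

lemma op_add:
  "x \<in> space S \<Longrightarrow> f \<in> bounded_measurable S \<Longrightarrow> g \<in> bounded_measurable S \<Longrightarrow>
    \<T> (\<lambda>y. f y + g y) x = \<T> f x + \<T> g x"
  unfolding transition_op_def using integrable_bounded_measurable[OF P_prob[of x]] by simp

lemma op_diff:
  "x \<in> space S \<Longrightarrow> f \<in> bounded_measurable S \<Longrightarrow> g \<in> bounded_measurable S \<Longrightarrow>
    \<T> (\<lambda>y. f y - g y) x = \<T> f x - \<T> g x"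
  unfolding transition_op_def using integrable_bounded_measurable[OF P_prob[of x]] by simp

lemma op_cmult: "\<T> (\<lambda>y. c * f y) x = c * \<T> f x"
  by (simp add: transition_op_def)

lemma op_const: "x \<in> space S \<Longrightarrow> \<T> (\<lambda>_. c) x = c"
proof -
  assume "x \<in> space S"
  then interpret prob_space "P x" using P_prob[of x] by (simp add: space_prob_algebra)
  show ?thesis by (simp add: transition_op_def prob_space)
qed

lemma op_power2_le:
  "x \<in> space S \<Longrightarrow> f \<in> bounded_measurable S \<Longrightarrow> (\<T> f x)\<^sup>2 \<le> \<T> (\<lambda>y. (f y)\<^sup>2) x"
  unfolding transition_op_def by (rule integral_square_le[OF P_prob])

lemma op_iter_cong:
  "x \<in> space S \<Longrightarrow> (\<And>y. y \<in> space S \<Longrightarrow> f y = g y) \<Longrightarrow> (\<T> ^^ n) f x = (\<T> ^^ n) g x"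
proof (induction n arbitrary: x)
  case (Suc n)
  then show ?case by (auto intro!: op_cong)
qed simp

lemma op_iter_diff:
  assumes "x \<in> space S" "f \<in> bounded_measurable S" "g \<in> bounded_measurable S"
  shows "(\<T> ^^ n) (\<lambda>y. f y - g y) x = (\<T> ^^ n) f x - (\<T> ^^ n) g x"
  using assms(1)
proof (induction n arbitrary: x)
  case (Suc n)
  have "(\<T> ^^ Suc n) (\<lambda>y. f y - g y) x = \<T> (\<lambda>y. (\<T> ^^ n) f y - (\<T> ^^ n) g y) x"
    using Suc by (auto intro!: op_cong)
  with Suc.prems assms show ?case by (simp add: op_diff op_iter_bounded_measurable)
qed simp

lemma op_iter_cmult:
  assumes "x \<in> space S"
  shows "(\<T> ^^ n) (\<lambda>y. c * f y) x = c * (\<T> ^^ n) f x"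
  using assms
proof (induction n arbitrary: x)
  case (Suc n)
  have "(\<T> ^^ Suc n) (\<lambda>y. c * f y) x = \<T> (\<lambda>y. c * (\<T> ^^ n) f y) x"
    using Suc by (auto intro!: op_cong)
  then show ?case by (simp add: op_cmult)
qed simp

lemma op_iter_const:
  assumes "x \<in> space S"
  shows "(\<T> ^^ n) (\<lambda>_. c) x = c"
  using assms
proof (induction n arbitrary: x)
  case (Suc n)
  have "(\<T> ^^ Suc n) (\<lambda>_. c) x = \<T> (\<lambda>_. c) x"
    using Suc by (auto intro!: op_cong)
  with Suc.prems show ?case by (simp add: op_const)
qed simp

end

locale reversible_kernel = markov_kernel +
  fixes \<pi> :: "'a measure"
  assumes invariant: "invariant_prob S P \<pi>"
    and reversible: "reversible_wrt S P \<pi>"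
begin

lemma pi_prob: "\<pi> \<in> space (prob_algebra S)"
  using invariant by (simp add: invariant_prob_def)

lemma sets_pi [measurable_cong]: "sets \<pi> = sets S" and space_pi: "space \<pi> = space S"
  using pi_prob by (auto simp: space_prob_algebra dest: sets_eq_imp_space_eq)

lemma integral_op: "f \<in> bounded_measurable S \<Longrightarrow> (\<integral>x. \<T> f x \<partial>\<pi>) = (\<integral>x. f x \<partial>\<pi>)"
  using integral_bind_kernel[OF pi_prob, of f] invariant by (simp add: invariant_prob_def)

text \<open>The two measures in the definition of reversibility are compared on the function
  \<open>(x, y) \<mapsto> f x * g y\<close>.\<close>

lemma op_self_adjoint:
  assumes f: "f \<in> bounded_measurable S" and g: "g \<in> bounded_measurable S"
  shows "(\<integral>x. f x * \<T> g x \<partial>\<pi>) = (\<integral>x. \<T> f x * g x \<partial>\<pi>)"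
proof -
  let ?SS = "S \<Otimes>\<^sub>M S"
  let ?F = "\<lambda>(x, y). f x * g y"
  obtain A where fm[measurable]: "f \<in> borel_measurable S" and fb: "\<And>x. x \<in> space S \<Longrightarrow> \<bar>f x\<bar> \<le> A" "0 \<le> A"
    using f by (metis bounded_measurableE)
  obtain B where gm[measurable]: "g \<in> borel_measurable S" and gb: "\<And>x. x \<in> space S \<Longrightarrow> \<bar>g x\<bar> \<le> B" "0 \<le> B"
    using g by (metis bounded_measurableE)
  have F: "?F \<in> bounded_measurable ?SS"
  proof (rule bounded_measurableI)
    show "?F \<in> borel_measurable ?SS" by measurable
    fix z assume "z \<in> space ?SS"
    then show "\<bar>?F z\<bar> \<le> A * B"
      by (auto simp: space_pair_measure abs_mult intro!: mult_mono fb gb)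
  qed
  have r1: "(\<lambda>y. return ?SS (x, y)) \<in> S \<rightarrow>\<^sub>M prob_algebra ?SS" if "x \<in> space S" for x
    using that by (intro measurable_compose[OF _ measurable_return_prob_space]) auto
  have r2: "(\<lambda>x. return ?SS (x, y)) \<in> S \<rightarrow>\<^sub>M prob_algebra ?SS" if "y \<in> space S" for y
    using that by (intro measurable_compose[OF _ measurable_return_prob_space]) auto
  have K1: "(\<lambda>x. P x \<bind> (\<lambda>y. return ?SS (x, y))) \<in> S \<rightarrow>\<^sub>M prob_algebra ?SS"
    by (rule measurable_bind_prob_space2[OF kernel]) (simp add: split_beta')
  have K2: "(\<lambda>y. P y \<bind> (\<lambda>x. return ?SS (x, y))) \<in> S \<rightarrow>\<^sub>M prob_algebra ?SS"
  proof (rule measurable_bind_prob_space2[OF kernel])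
    have "(\<lambda>z. return ?SS (snd z, fst z)) \<in> ?SS \<rightarrow>\<^sub>M prob_algebra ?SS"
      by (intro measurable_compose[OF _ measurable_return_prob_space]) measurable
    then show "(\<lambda>(y, x). return ?SS (x, y)) \<in> ?SS \<rightarrow>\<^sub>M prob_algebra ?SS"
      by (simp add: split_beta')
  qed
  have spP: "space (P x) = space S" if "x \<in> space S" for x
    using P_prob[OF that] by (auto simp: space_prob_algebra dest: sets_eq_imp_space_eq)
  have ret: "(\<integral>z. ?F z \<partial>return ?SS (x, y)) = f x * g y" if "x \<in> space S" "y \<in> space S" for x y
    using that by (subst integral_return) (auto simp: space_pair_measure)
  have "(\<integral>x. f x * \<T> g x \<partial>\<pi>) = (\<integral>x. \<integral>z. ?F z \<partial>(P x \<bind> (\<lambda>y. return ?SS (x, y))) \<partial>\<pi>)"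
  proof (rule Bochner_Integration.integral_cong[OF refl])
    fix x assume "x \<in> space \<pi>"
    then have x: "x \<in> space S" by (simp add: space_pi)
    have "(\<integral>z. ?F z \<partial>(P x \<bind> (\<lambda>y. return ?SS (x, y)))) = (\<integral>y. \<integral>z. ?F z \<partial>return ?SS (x, y) \<partial>P x)"
      by (rule integral_bind_bounded[OF P_prob[OF x] r1[OF x] F])
    also have "\<dots> = (\<integral>y. f x * g y \<partial>P x)"
      by (rule Bochner_Integration.integral_cong[OF refl]) (simp only: spP[OF x] ret[OF x])
    finally show "f x * \<T> g x = (\<integral>z. ?F z \<partial>(P x \<bind> (\<lambda>y. return ?SS (x, y))))"
      by (simp add: transition_op_def)
  qed
  also have "\<dots> = (\<integral>z. ?F z \<partial>(\<pi> \<bind> (\<lambda>x. P x \<bind> (\<lambda>y. return ?SS (x, y)))))"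
    by (rule integral_bind_bounded[OF pi_prob K1 F, symmetric])
  also have "\<dots> = (\<integral>z. ?F z \<partial>(\<pi> \<bind> (\<lambda>y. P y \<bind> (\<lambda>x. return ?SS (x, y)))))"
    using reversible by (simp add: reversible_wrt_def)
  also have "\<dots> = (\<integral>y. \<integral>z. ?F z \<partial>(P y \<bind> (\<lambda>x. return ?SS (x, y))) \<partial>\<pi>)"
    by (rule integral_bind_bounded[OF pi_prob K2 F])
  also have "\<dots> = (\<integral>y. \<T> f y * g y \<partial>\<pi>)"
  proof (rule Bochner_Integration.integral_cong[OF refl])
    fix y assume "y \<in> space \<pi>"
    then have y: "y \<in> space S" by (simp add: space_pi)
    have "(\<integral>z. ?F z \<partial>(P y \<bind> (\<lambda>x. return ?SS (x, y)))) = (\<integral>x. \<integral>z. ?F z \<partial>return ?SS (x, y) \<partial>P y)"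
      by (rule integral_bind_bounded[OF P_prob[OF y] r2[OF y] F])
    also have "\<dots> = (\<integral>x. f x * g y \<partial>P y)"
      by (rule Bochner_Integration.integral_cong[OF refl]) (simp only: spP[OF y] ret[OF _ y])
    finally show "(\<integral>z. ?F z \<partial>(P y \<bind> (\<lambda>x. return ?SS (x, y)))) = \<T> f y * g y"
      by (simp add: transition_op_def)
  qed
  finally show ?thesis .
qed

text \<open>A semidefinite form: functions that vanish almost everywhere have norm zero.\<close>

definition inner_pi :: "('a \<Rightarrow> real) \<Rightarrow> ('a \<Rightarrow> real) \<Rightarrow> real" where
  "inner_pi f g = (\<integral>x. f x * g x \<partial>\<pi>)"

lemma inner_pi_integrable:
  "f \<in> bounded_measurable S \<Longrightarrow> g \<in> bounded_measurable S \<Longrightarrow> integrable \<pi> (\<lambda>x. f x * g x)"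
  by (intro integrable_bounded_measurable[OF pi_prob] bounded_measurable_mult)

lemma inner_pi_cong:
  "(\<And>x. x \<in> space S \<Longrightarrow> f x = f' x) \<Longrightarrow> (\<And>x. x \<in> space S \<Longrightarrow> g x = g' x) \<Longrightarrow> inner_pi f g = inner_pi f' g'"
  unfolding inner_pi_def by (intro Bochner_Integration.integral_cong) (auto simp: space_pi)

lemma inner_pi_commute: "inner_pi f g = inner_pi g f"
  by (simp add: inner_pi_def mult.commute)

lemma inner_pi_add_left:
  assumes "f \<in> bounded_measurable S" "g \<in> bounded_measurable S" "h \<in> bounded_measurable S"
  shows "inner_pi (\<lambda>x. f x + g x) h = inner_pi f h + inner_pi g h"
  unfolding inner_pi_def using assms by (simp add: distrib_right inner_pi_integrable)

lemma inner_pi_diff_left: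
  assumes "f \<in> bounded_measurable S" "g \<in> bounded_measurable S" "h \<in> bounded_measurable S"
  shows "inner_pi (\<lambda>x. f x - g x) h = inner_pi f h - inner_pi g h"
  unfolding inner_pi_def using assms by (simp add: left_diff_distrib inner_pi_integrable)

lemma inner_pi_cmult_left: "inner_pi (\<lambda>x. c * f x) h = c * inner_pi f h"
  unfolding inner_pi_def by (simp add: mult.assoc)

lemma inner_pi_add_right:
  assumes "f \<in> bounded_measurable S" "g \<in> bounded_measurable S" "h \<in> bounded_measurable S"
  shows "inner_pi h (\<lambda>x. f x + g x) = inner_pi h f + inner_pi h g"
  using inner_pi_add_left[OF assms] by (simp add: inner_pi_commute)

lemma inner_pi_diff_right:
  assumes "f \<in> bounded_measurable S" "g \<in> bounded_measurable S" "h \<in> bounded_measurable S"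
  shows "inner_pi h (\<lambda>x. f x - g x) = inner_pi h f - inner_pi h g"
  using inner_pi_diff_left[OF assms] by (simp add: inner_pi_commute)

lemma inner_pi_cmult_right: "inner_pi h (\<lambda>x. c * f x) = c * inner_pi h f"
  unfolding inner_pi_def by (simp add: mult.left_commute)

lemma inner_pi_nonneg: "0 \<le> inner_pi f f"
  unfolding inner_pi_def by (rule Bochner_Integration.integral_nonneg) simp

lemma inner_pi_op:
  "f \<in> bounded_measurable S \<Longrightarrow> g \<in> bounded_measurable S \<Longrightarrow> inner_pi (\<T> f) g = inner_pi f (\<T> g)"
  unfolding inner_pi_def by (simp add: op_self_adjoint)

lemma inner_pi_op_iter:
  "f \<in> bounded_measurable S \<Longrightarrow> g \<in> bounded_measurable S \<Longrightarrow>
    inner_pi ((\<T> ^^ m) f) ((\<T> ^^ n) g) = inner_pi f ((\<T> ^^ (m + n)) g)"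
proof (induction m arbitrary: n)
  case (Suc m)
  have "inner_pi ((\<T> ^^ Suc m) f) ((\<T> ^^ n) g) = inner_pi ((\<T> ^^ m) f) ((\<T> ^^ Suc n) g)"
    using Suc.prems by (simp add: inner_pi_op op_iter_bounded_measurable)
  then show ?case using Suc.IH[OF Suc.prems, of "Suc n"] by simp
qed simp

text \<open>Jensen's inequality for the kernel, then invariance.\<close>

lemma inner_pi_op_le:
  assumes f: "f \<in> bounded_measurable S"
  shows "inner_pi (\<T> f) (\<T> f) \<le> inner_pi f f"
proof -
  have "inner_pi (\<T> f) (\<T> f) \<le> (\<integral>x. \<T> (\<lambda>y. (f y)\<^sup>2) x \<partial>\<pi>)"
    unfolding inner_pi_def power2_eq_square[symmetric]
    using f by (intro integral_mono integrable_bounded_measurable[OF pi_prob]) (auto simp: op_power2_le space_pi)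
  also have "\<dots> = (\<integral>x. (f x)\<^sup>2 \<partial>\<pi>)"
    using f by (intro integral_op) auto
  finally show ?thesis by (simp add: inner_pi_def power2_eq_square)
qed

text \<open>The quadratic polynomial \<open>inner_pi (f + t g) (f + t g)\<close> in \<open>t\<close> is nonnegative. As the form is
  only semidefinite, \<open>inner_pi g g = 0\<close> needs its own argument.\<close>

lemma inner_pi_Cauchy_Schwarz:
  assumes f: "f \<in> bounded_measurable S" and g: "g \<in> bounded_measurable S"
  shows "(inner_pi f g)\<^sup>2 \<le> inner_pi f f * inner_pi g g"
proof -
  have "0 \<le> inner_pi f f + 2 * t * inner_pi f g + t\<^sup>2 * inner_pi g g" for t
  proof -
    have "0 \<le> inner_pi (\<lambda>x. f x + t * g x) (\<lambda>x. f x + t * g x)" by (rule inner_pi_nonneg)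
    also have "\<dots> = inner_pi f f + 2 * t * inner_pi f g + t\<^sup>2 * inner_pi g g"
      using f g
      by (simp add: inner_pi_add_left inner_pi_add_right bounded_measurable_add bounded_measurable_cmult
          inner_pi_cmult_left inner_pi_cmult_right inner_pi_commute[of g f] power2_eq_square algebra_simps)
    finally show ?thesis .
  qed
  note q = this
  show ?thesis
  proof (cases "inner_pi g g = 0")
    case False
    then have pos: "inner_pi g g > 0" using inner_pi_nonneg[of g] by simp
    have "0 \<le> inner_pi g g * (inner_pi f f + 2 * (- inner_pi f g / inner_pi g g) * inner_pi f g
        + (- inner_pi f g / inner_pi g g)\<^sup>2 * inner_pi g g)"
      by (intro mult_nonneg_nonneg q inner_pi_nonneg)
    also have "\<dots> = inner_pi f f * inner_pi g g - (inner_pi f g)\<^sup>2"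
      using pos by (simp add: field_simps power2_eq_square)
    finally show ?thesis by simp
  next
    case True
    have "inner_pi f g = 0"
    proof (rule ccontr)
      assume nz: "inner_pi f g \<noteq> 0"
      \<comment> \<open>At this \<open>t\<close> the polynomial, now affine, takes the value \<open>- 1\<close>.\<close>
      have "0 \<le> inner_pi f f + 2 * (- (inner_pi f f + 1) / (2 * inner_pi f g)) * inner_pi f g"
        using q[of "- (inner_pi f f + 1) / (2 * inner_pi f g)"] True by simp
      also have "2 * (- (inner_pi f f + 1) / (2 * inner_pi f g)) * inner_pi f g = - (inner_pi f f + 1)"
        using nz by simp
      finally show False by linarith
    qed
    then show ?thesis by (simp add: True)
  qed
qed

end

section \<open>Regeneration and the invariant probability\<close>

lemma scaled_measure_integral_le:
  assumes \<nu>: "\<nu> \<in> space (prob_algebra S)" and \<kappa>: "\<kappa> \<in> space (prob_algebra S)" and c: "0 \<le> c"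
    and le: "\<And>A. A \<in> sets S \<Longrightarrow> c * measure \<nu> A \<le> measure \<kappa> A"
    and f: "f \<in> bounded_measurable S" "\<And>x. x \<in> space S \<Longrightarrow> 0 \<le> f x"
  shows "c * (\<integral>x. f x \<partial>\<nu>) \<le> (\<integral>x. f x \<partial>\<kappa>)"
proof -
  interpret \<nu>: prob_space \<nu> using \<nu> by (simp add: space_prob_algebra)
  interpret \<kappa>: prob_space \<kappa> using \<kappa> by (simp add: space_prob_algebra)
  have s: "sets \<nu> = sets S" "space \<nu> = space S" "sets \<kappa> = sets S" "space \<kappa> = space S"
    using \<nu> \<kappa> by (auto simp: space_prob_algebra dest: sets_eq_imp_space_eq)
  have fm: "f \<in> borel_measurable S" using f(1) by (metis bounded_measurableE)
  have "ennreal c * (\<integral>\<^sup>+x. f x \<partial>\<nu>) = (\<integral>\<^sup>+x. f x \<partial>scale_measure (ennreal c) \<nu>)"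
    by (rule nn_integral_scale_measure[symmetric]) (use fm s in \<open>simp cong: measurable_cong_sets\<close>)
  also have "\<dots> \<le> (\<integral>\<^sup>+x. f x \<partial>\<kappa>)"
  proof (intro nn_integral_mono_measure le_measure[THEN iffD2] ballI)
    fix A assume "A \<in> sets (scale_measure (ennreal c) \<nu>)"
    then have "A \<in> sets S" by (simp add: s)
    then have "ennreal (c * measure \<nu> A) \<le> ennreal (measure \<kappa> A)"
      by (intro ennreal_leI le)
    then show "emeasure (scale_measure (ennreal c) \<nu>) A \<le> emeasure \<kappa> A"
      using c by (simp add: \<nu>.emeasure_eq_measure \<kappa>.emeasure_eq_measure ennreal_mult)
  qed (simp_all add: s)
  also have "(\<integral>\<^sup>+x. f x \<partial>\<kappa>) = ennreal (\<integral>x. f x \<partial>\<kappa>)"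
    using integrable_bounded_measurable[OF \<kappa> f(1)] f(2) s by (intro nn_integral_eq_integral AE_I2) auto
  also have "(\<integral>\<^sup>+x. f x \<partial>\<nu>) = ennreal (\<integral>x. f x \<partial>\<nu>)"
    using integrable_bounded_measurable[OF \<nu> f(1)] f(2) s by (intro nn_integral_eq_integral AE_I2) auto
  also have "ennreal c * ennreal (\<integral>x. f x \<partial>\<nu>) = ennreal (c * (\<integral>x. f x \<partial>\<nu>))"
    using c by (rule ennreal_mult'[symmetric])
  finally have "ennreal (c * (\<integral>x. f x \<partial>\<nu>)) \<le> ennreal (\<integral>x. f x \<partial>\<kappa>)" .
  moreover have "0 \<le> (\<integral>x. f x \<partial>\<kappa>)"
    by (rule Bochner_Integration.integral_nonneg) (simp add: f(2) s)
  ultimately show ?thesis by (simp only: ennreal_le_iff)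
qed

text \<open>A function with values in \<open>[0, 1]\<close> is within \<open>1 / k\<close> of a combination of \<open>k\<close> indicators, and
  both functionals are monotone, so agreement on indicators forces agreement.\<close>

lemma positive_functional_eq_integral:
  assumes \<kappa>: "\<kappa> \<in> space (prob_algebra S)"
    and add: "\<And>f g. f \<in> bounded_measurable S \<Longrightarrow> g \<in> bounded_measurable S \<Longrightarrow> J (\<lambda>x. f x + g x) = J f + J g"
    and cmult: "\<And>c f. f \<in> bounded_measurable S \<Longrightarrow> J (\<lambda>x. c * f x) = c * J f"
    and nonneg: "\<And>f. f \<in> bounded_measurable S \<Longrightarrow> (\<And>x. x \<in> space S \<Longrightarrow> 0 \<le> f x) \<Longrightarrow> 0 \<le> J f"
    and ind: "\<And>A. A \<in> sets S \<Longrightarrow> J (indicator A) = measure \<kappa> A"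
    and f: "f \<in> bounded_measurable S" and f01: "\<And>x. x \<in> space S \<Longrightarrow> 0 \<le> f x \<and> f x \<le> 1"
  shows "J f = (\<integral>x. f x \<partial>\<kappa>)"
proof -
  interpret \<kappa>: prob_space \<kappa> using \<kappa> by (simp add: space_prob_algebra)
  have s[measurable_cong]: "sets \<kappa> = sets S" and sp: "space \<kappa> = space S"
    using \<kappa> by (auto simp: space_prob_algebra dest: sets_eq_imp_space_eq)
  have fm[measurable]: "f \<in> borel_measurable S" using f by (metis bounded_measurableE)
  \<comment> \<open>\<open>F k = \<lfloor>k f\<rfloor> / k\<close>, as a sum over its level sets.\<close>
  define A where "A k i = {x \<in> space S. real i / real k \<le> f x}" for k i
  have A: "A k i \<in> sets S" for k i unfolding A_def by measurable
  define F where "F k x = (\<Sum>i\<in>{1..k}. 1 / real k * indicator (A k i) x)" for k x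
  have bm_sum: "(\<lambda>x. \<Sum>i\<in>I. 1 / real k * indicator (A k i) x) \<in> bounded_measurable S" if "finite I" for I k
    using that
  proof (induction I rule: finite_induct)
    case (insert i I)
    from bounded_measurable_add[OF bounded_measurable_cmult[OF bounded_measurable_indicator[OF A[of k i]], of "1 / real k"] insert.IH]
    show ?case using insert.hyps by simp
  qed simp
  have F_bm: "F k \<in> bounded_measurable S" for k
    unfolding F_def[abs_def] by (rule bm_sum) simp
  have diff: "J (\<lambda>x. f x - g x) = J f - J g" if f: "f \<in> bounded_measurable S" and g: "g \<in> bounded_measurable S" for f g
    using add[OF f bounded_measurable_cmult[OF g, of "-1"]] cmult[OF g, of "-1"] by simp
  have J0: "J (\<lambda>x. 0) = 0" using cmult[of "\<lambda>_. 0" 0] by simp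
  have J_sum: "J (\<lambda>x. \<Sum>i\<in>I. 1 / real k * indicator (A k i) x) = (\<Sum>i\<in>I. 1 / real k * measure \<kappa> (A k i))"
    if "finite I" for I k
    using that
  proof (induction I rule: finite_induct)
    case (insert i I)
    note bm = bounded_measurable_indicator[OF A[of k i]]
    have "J (\<lambda>x. 1 / real k * indicator (A k i) x + (\<Sum>i\<in>I. 1 / real k * indicator (A k i) x))
        = 1 / real k * measure \<kappa> (A k i) + (\<Sum>i\<in>I. 1 / real k * measure \<kappa> (A k i))"
      by (simp only: add[OF bounded_measurable_cmult[OF bm] bm_sum[OF insert.hyps(1)]] cmult[OF bm] ind[OF A] insert.IH)
    then show ?case using insert.hyps by simp
  qed (simp add: J0)
  have int_F: "(\<integral>x. F k x \<partial>\<kappa>) = J (F k)" for k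
  proof -
    have "(\<integral>x. F k x \<partial>\<kappa>) = (\<Sum>i\<in>{1..k}. 1 / real k * measure \<kappa> (A k i))"
      unfolding F_def using A integrable_bounded_measurable[OF \<kappa>] 
      by (subst Bochner_Integration.integral_sum) (auto simp: s intro!: integrable_bounded_measurable[OF \<kappa>] bounded_measurable_cmult)
    also have "\<dots> = J (F k)" unfolding F_def[abs_def] by (rule J_sum[symmetric]) simp
    finally show ?thesis .
  qed
  have F_approx: "F k x \<le> f x \<and> f x \<le> F k x + 1 / real k" if k: "k > 0" and x: "x \<in> space S" for k x
  proof -
    define m where "m = nat \<lfloor>real k * f x\<rfloor>"
    have kf: "0 \<le> real k * f x" "real k * f x \<le> real k"
      using f01[OF x] by (auto simp: mult_left_le)
    have m: "real m \<le> real k * f x" "real k * f x < real m + 1" "m \<le> k"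
      using kf unfolding m_def by (linarith, linarith, linarith)
    have "F k x = 1 / real k * (\<Sum>i\<in>{1..k}. indicator (A k i) x)"
      by (simp add: F_def sum_distrib_left)
    also have "(\<Sum>i\<in>{1..k}. indicator (A k i) x) = (\<Sum>i\<in>{1..m}. 1 :: real)"
    proof (rule sum.mono_neutral_cong_right)
      show "\<forall>i\<in>{1..k} - {1..m}. indicator (A k i) x = (0 :: real)"
      proof
        fix i assume "i \<in> {1..k} - {1..m}"
        then have "real i \<ge> real m + 1" by auto
        with m have "real k * f x < real i" by linarith
        then show "indicator (A k i) x = (0 :: real)"
          using k by (simp add: A_def indicator_def field_simps)
      qed
      fix i assume "i \<in> {1..m}"
      then have "real i \<le> real k * f x" using m by (auto intro: order_trans)
      then show "indicator (A k i) x = (1 :: real)"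
        using k x by (simp add: A_def indicator_def field_simps)
    qed (use m in auto)
    finally have "F k x = real m / real k" by simp
    moreover have "real m / real k \<le> f x" "f x \<le> (real m + 1) / real k"
      using m k by (simp_all add: pos_divide_le_eq pos_le_divide_eq mult.commute)
    ultimately show ?thesis by (simp add: add_divide_distrib)
  qed
  have close: "\<bar>J f - (\<integral>x. f x \<partial>\<kappa>)\<bar> \<le> 1 / real k" if k: "k > 0" for k :: nat
  proof -
    have "0 \<le> J (\<lambda>x. f x - F k x)"
      using F_approx[OF k] f F_bm by (intro nonneg) auto
    then have 1: "J (F k) \<le> J f" by (simp add: diff f F_bm)
    note sp_bm = bounded_measurable_indicator[OF sets.top[of S]]
    have "0 \<le> J (\<lambda>x. (F k x - f x) + 1 / real k * indicator (space S) x)"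
    proof (rule nonneg)
      show "(\<lambda>x. (F k x - f x) + 1 / real k * indicator (space S) x) \<in> bounded_measurable S"
        by (intro bounded_measurable_add bounded_measurable_diff bounded_measurable_cmult F_bm f sp_bm)
      show "0 \<le> (F k x - f x) + 1 / real k * indicator (space S) x" if "x \<in> space S" for x
        using F_approx[OF k that] that by simp
    qed
    also have "\<dots> = (J (F k) - J f) + 1 / real k * measure \<kappa> (space S)"
      by (simp only: add[OF bounded_measurable_diff[OF F_bm f] bounded_measurable_cmult[OF sp_bm]]
          diff[OF F_bm f] cmult[OF sp_bm] ind[OF sets.top])
    finally have 2: "J f \<le> J (F k) + 1 / real k"
      using \<kappa>.prob_space by (simp add: sp)
    have 3: "(\<integral>x. F k x \<partial>\<kappa>) \<le> (\<integral>x. f x \<partial>\<kappa>)"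
      using F_approx[OF k] f F_bm
      by (intro integral_mono integrable_bounded_measurable[OF \<kappa>]) (auto simp: sp)
    have "(\<integral>x. f x \<partial>\<kappa>) \<le> (\<integral>x. F k x + 1 / real k \<partial>\<kappa>)"
      using F_approx[OF k] f F_bm
      by (intro integral_mono integrable_bounded_measurable[OF \<kappa>]) (auto simp: sp)
    also have "\<dots> = (\<integral>x. F k x \<partial>\<kappa>) + 1 / real k"
      using integrable_bounded_measurable[OF \<kappa> F_bm] by (simp add: \<kappa>.prob_space)
    finally show ?thesis using 1 2 3 int_F[of k] by linarith
  qed
  have "\<bar>J f - (\<integral>x. f x \<partial>\<kappa>)\<bar> \<le> 0"
  proof (rule field_le_epsilon)
    fix e :: real assume "e > 0"
    then obtain k where "k > 0" "1 / real k < e"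
      using reals_Archimedean[of e] by (metis inverse_eq_divide zero_less_Suc)
    with close[of k] show "\<bar>J f - (\<integral>x. f x \<partial>\<kappa>)\<bar> \<le> 0 + e" by simp
  qed
  then show ?thesis by simp
qed

text \<open>A kernel that regenerates from \<open>C\<close>: on \<open>C\<close>, with probability \<open>\<beta>'\<close>, the next state is drawn
  from \<open>\<nu>\<close>. A cycle starts at \<open>\<nu>\<close>, and its length has law \<open>b\<close>.\<close>

locale minorized_kernel = markov_kernel +
  fixes \<nu> :: "'a measure" and C :: "'a set" and \<beta>' :: real and u b :: "nat \<Rightarrow> real" and R L :: real
  assumes C [measurable]: "C \<in> sets S"
    and \<beta>'_pos: "\<beta>' > 0"
    and \<nu>: "\<nu> \<in> space (prob_algebra S)"
    and minorization: "\<And>x A. x \<in> space S \<Longrightarrow> A \<in> sets S \<Longrightarrow>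
          measure (P x) A \<ge> \<beta>' * indicator C x * measure \<nu> A"
    and u_Suc: "\<And>n. u (Suc n) = \<beta>' * (\<integral>x. (transition_op P ^^ n) (indicator C) x \<partial>\<nu>)"
    and increments: "increment_sequence b"
    and renewal: "renewal_sequence_of b u"
    and R: "R > 1"
    and b_summable: "summable (\<lambda>n. b (Suc n) * R ^ Suc n)"
    and b_bound: "(\<Sum>n. b (Suc n) * R ^ Suc n) \<le> L"
begin

sublocale geometric_increments b R L
  using increments R b_summable b_bound by unfold_locales

lemma minorization_integral:
  assumes "x \<in> space S" "f \<in> bounded_measurable S" "\<And>y. y \<in> space S \<Longrightarrow> 0 \<le> f y"
  shows "\<beta>' * indicator C x * (\<integral>y. f y \<partial>\<nu>) \<le> \<T> f x"
  unfolding transition_op_def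
proof (rule scaled_measure_integral_le[OF \<nu> P_prob[OF assms(1)] _ minorization[OF assms(1)] assms(2,3)])
  show "0 \<le> \<beta>' * indicator C x" using \<beta>'_pos by (simp add: indicator_def)
qed

text \<open>With \<open>Q = P - \<beta>' 1\<^sub>C \<otimes> \<nu>\<close>, the kernel of steps without regeneration, this is \<open>\<integral> Q\<^sup>n f d\<nu>\<close>, the
  expectation of \<open>f\<close> after \<open>n\<close> steps of a cycle restricted to the event that the cycle still goes
  on. The decomposition of \<open>P\<^sup>n\<close> at the regeneration times expresses it through integrals of
  powers of \<open>P\<close> alone, so countable additivity in \<open>f\<close> is inherited from genuine measures.\<close>

definition excursion :: "nat \<Rightarrow> ('a \<Rightarrow> real) \<Rightarrow> real" where
  "excursion n f = (\<integral>x. (\<T> ^^ n) f x \<partial>\<nu>) - (\<Sum>j=1..n. b j * (\<integral>x. (\<T> ^^ (n - j)) f x \<partial>\<nu>))"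

lemma excursion_Suc: "excursion (Suc n) f = excursion n (\<T> f) - b (Suc n) * (\<integral>x. f x \<partial>\<nu>)"
proof -
  have "(\<Sum>j=1..n. b j * (\<integral>x. (\<T> ^^ (Suc n - j)) f x \<partial>\<nu>)) = (\<Sum>j=1..n. b j * (\<integral>x. (\<T> ^^ (n - j)) (\<T> f) x \<partial>\<nu>))"
    by (intro sum.cong refl) (simp add: Suc_diff_le funpow_swap1)
  then show ?thesis by (simp add: excursion_def funpow_swap1)
qed

text \<open>The cycle ends with step \<open>n + 1\<close> if it has lasted \<open>n\<close> steps, is in \<open>C\<close>, and then regenerates.\<close>

lemma increment_eq_excursion: "b (Suc n) = \<beta>' * excursion n (indicator C)"
proof -
  have "u (Suc n) = (\<Sum>k=1..Suc n. b k * u (Suc n - k))"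
    using renewal unfolding renewal_sequence_of_def by auto
  also have "\<dots> = (\<Sum>k=1..n. b k * u (Suc n - k)) + b (Suc n)"
    using renewal by (simp add: renewal_sequence_of_def)
  also have "(\<Sum>k=1..n. b k * u (Suc n - k)) = (\<Sum>k=1..n. \<beta>' * (b k * (\<integral>x. (\<T> ^^ (n - k)) (indicator C) x \<partial>\<nu>)))"
    by (intro sum.cong refl) (simp add: Suc_diff_le u_Suc)
  finally show ?thesis
    by (simp add: excursion_def u_Suc right_diff_distrib sum_distrib_left)
qed

lemma integral_op_iter:
  assumes "f \<in> bounded_measurable S"
  shows "(\<integral>x. (\<T> ^^ n) f x \<partial>\<nu>) = (\<integral>x. f x \<partial>step_law P \<nu> n)"
  using integral_step_law[OF \<nu> assms] by simp

lemma excursion_add: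
  assumes "f \<in> bounded_measurable S" "g \<in> bounded_measurable S"
  shows "excursion n (\<lambda>x. f x + g x) = excursion n f + excursion n g"
proof -
  have "(\<integral>x. f x + g x \<partial>step_law P \<nu> k) = (\<integral>x. f x \<partial>step_law P \<nu> k) + (\<integral>x. g x \<partial>step_law P \<nu> k)" for k
    using assms
    by (intro Bochner_Integration.integral_add integrable_bounded_measurable[OF step_law_in_prob_algebra[OF kernel \<nu>]])
  then show ?thesis
    unfolding excursion_def integral_op_iter[OF assms(1)] integral_op_iter[OF assms(2)] integral_op_iter[OF bounded_measurable_add[OF assms]]
    by (simp add: distrib_left sum.distrib)
qed

lemma excursion_cmult:
  assumes "f \<in> bounded_measurable S"
  shows "excursion n (\<lambda>x. c * f x) = c * excursion n f"
  unfolding excursion_def integral_op_iter[OF assms] integral_op_iter[OF bounded_measurable_cmult[OF assms]]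
  by (simp add: right_diff_distrib sum_distrib_left mult.left_commute)

text \<open>The formula is a difference, but each step replaces \<open>f\<close> by
  \<open>P f - \<beta>' 1\<^sub>C \<integral> f d\<nu>\<close>, which is nonnegative by the minorization.\<close>

lemma excursion_nonneg:
  assumes "f \<in> bounded_measurable S" "\<And>x. x \<in> space S \<Longrightarrow> 0 \<le> f x"
  shows "0 \<le> excursion n f"
  using assms
proof (induction n arbitrary: f)
  case 0
  have "space \<nu> = space S" using \<nu> by (auto simp: space_prob_algebra dest: sets_eq_imp_space_eq)
  with 0 show ?case by (auto simp: excursion_def intro!: integral_nonneg_AE AE_I2)
next
  case (Suc n)
  let ?c = "\<beta>' * (\<integral>x. f x \<partial>\<nu>)"
  have C': "indicator C \<in> bounded_measurable S" using C by (rule bounded_measurable_indicator)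
  have "excursion (Suc n) f = excursion n (\<T> f) + (- ?c) * excursion n (indicator C)"
    by (simp add: excursion_Suc increment_eq_excursion[of n])
  also have "\<dots> = excursion n (\<lambda>x. \<T> f x + (- ?c) * indicator C x)"
    by (simp only: excursion_add[OF op_bounded_measurable[OF Suc.prems(1)] bounded_measurable_cmult[OF C']] excursion_cmult[OF C'])
  also have "\<dots> \<ge> 0"
  proof (rule Suc.IH)
    show "0 \<le> \<T> f x + (- ?c) * indicator C x" if "x \<in> space S" for x
      using minorization_integral[OF that Suc.prems] by (simp add: mult_ac)
  qed (intro bounded_measurable_add op_bounded_measurable bounded_measurable_cmult Suc.prems C')
  finally show ?case .
qed

lemma excursion_one: "excursion n (\<lambda>_. 1) = increment_tail b n"
proof -
  have "(\<integral>x. 1 \<partial>step_law P \<nu> k) = (1::real)" for k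
  proof -
    interpret prob_space "step_law P \<nu> k"
      using step_law_in_prob_algebra[OF kernel \<nu>, of k] by (simp add: space_prob_algebra)
    show ?thesis by (simp add: prob_space)
  qed
  then show ?thesis by (simp add: excursion_def integral_op_iter tail_eq)
qed

lemma excursion_summable:
  assumes f: "f \<in> bounded_measurable S"
  shows "summable (\<lambda>n. excursion n f)"
proof -
  obtain B where B: "\<And>x. x \<in> space S \<Longrightarrow> \<bar>f x\<bar> \<le> B" using f by (metis bounded_measurableE)
  have le: "\<bar>excursion n f\<bar> \<le> B * increment_tail b n" for n
  proof -
    have "0 \<le> B - f x" "0 \<le> B + f x" if "x \<in> space S" for x using B[OF that] by linarith+
    then have "0 \<le> excursion n (\<lambda>x. B * 1 + f x)" "0 \<le> excursion n (\<lambda>x. B * 1 + (-1) * f x)"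
      using f by (auto intro!: excursion_nonneg)
    then have "0 \<le> B * increment_tail b n + excursion n f" "0 \<le> B * increment_tail b n - excursion n f"
      using f by (simp_all only: excursion_add excursion_cmult excursion_one bounded_measurable_cmult bounded_measurable_const)
    then show ?thesis by linarith
  qed
  have sm: "summable (\<lambda>n. B * increment_tail b n)"
    using tail_powser_summable[of 1] R tail_nonneg by (intro summable_mult) simp
  show ?thesis by (rule summable_comparison_test'[OF sm, where N=0]) (simp add: le)
qed

lemma excursion_sums_UN:
  assumes A: "range A \<subseteq> sets S" "disjoint_family A"
  shows "(\<lambda>i. excursion n (indicator (A i))) sums excursion n (indicator (\<Union>i. A i))"
proof -
  have A': "A i \<in> sets S" for i using A by auto
  have s: "(\<lambda>i. measure (step_law P \<nu> k) (A i)) sums measure (step_law P \<nu> k) (\<Union>i. A i)" for k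
  proof -
    interpret prob_space "step_law P \<nu> k"
      using step_law_in_prob_algebra[OF kernel \<nu>, of k] by (simp add: space_prob_algebra)
    show ?thesis
      using A step_law_in_prob_algebra[OF kernel \<nu>, of k]
      by (intro finite_measure_UNION) (simp_all add: space_prob_algebra)
  qed
  have i: "(\<integral>x. (\<T> ^^ k) (indicator D) x \<partial>\<nu>) = measure (step_law P \<nu> k) D" if "D \<in> sets S" for D k
    using that step_law_in_prob_algebra[OF kernel \<nu>, of k]
    by (simp add: integral_op_iter bounded_measurable_indicator space_prob_algebra)
  show ?thesis
    unfolding excursion_def using A A' by (simp add: i sets.countable_UN) (intro sums_diff s sums_sum sums_mult)
qed

definition mean_cycle_length :: real where "mean_cycle_length = (\<Sum>n. increment_tail b n)"

lemma mean_cycle_length_ge_1: "1 \<le> mean_cycle_length"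
proof -
  have "summable (\<lambda>n. increment_tail b n)"
    using tail_powser_summable[of 1] R tail_nonneg by simp
  from sum_le_suminf[OF this, of "{0}"] show ?thesis
    by (simp add: mean_cycle_length_def tail_0 tail_nonneg)
qed

text \<open>Expected sum of \<open>f\<close> over one cycle, divided by the mean length of a cycle.\<close>

definition cycle_mean :: "('a \<Rightarrow> real) \<Rightarrow> real" where
  "cycle_mean f = (\<Sum>n. excursion n f) / mean_cycle_length"

text \<open>Shifting a cycle by one step loses its initial law \<open>\<nu>\<close> and gains the laws at its end, which are
  multiples of \<open>\<nu>\<close> with total mass \<open>\<Sum> b n = 1\<close>.\<close>

lemma cycle_mean_invariant:
  assumes f: "f \<in> bounded_measurable S"
  shows "cycle_mean (\<T> f) = cycle_mean f"
proof -
  have sm: "summable (\<lambda>n. excursion n f)" by (rule excursion_summable[OF f])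
  have "excursion n (\<T> f) = excursion (Suc n) f + b (Suc n) * (\<integral>x. f x \<partial>\<nu>)" for n
    by (simp add: excursion_Suc)
  then have "(\<Sum>n. excursion n (\<T> f)) = (\<Sum>n. excursion (Suc n) f + b (Suc n) * (\<integral>x. f x \<partial>\<nu>))" by simp
  also have "\<dots> = (\<Sum>n. excursion (Suc n) f) + (\<Sum>n. b (Suc n) * (\<integral>x. f x \<partial>\<nu>))"
    using b_sums by (intro suminf_add[symmetric] summable_mult2 summable_Suc_iff[THEN iffD2, OF sm]) (auto simp: sums_iff)
  also have "(\<Sum>n. b (Suc n) * (\<integral>x. f x \<partial>\<nu>)) = (\<integral>x. f x \<partial>\<nu>)"
    using b_sums by (simp add: sums_iff suminf_mult2[symmetric])
  also have "(\<integral>x. f x \<partial>\<nu>) = excursion 0 f" by (simp add: excursion_def)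
  finally show ?thesis using suminf_split_head[OF sm] by (simp add: cycle_mean_def)
qed

lemma invariant_prob_cycle_mean:
  obtains \<mu> where "invariant_prob S P \<mu>" "\<And>A. A \<in> sets S \<Longrightarrow> measure \<mu> A = cycle_mean (indicator A)"
proof -
  have T0: "mean_cycle_length > 0" using mean_cycle_length_ge_1 by simp
  have nn: "0 \<le> excursion n (indicator A)" if "A \<in> sets S" for A n
    using that by (intro excursion_nonneg) auto
  define m where "m A = (\<Sum>n. ennreal (excursion n (indicator A) / mean_cycle_length))" for A
  have m_eq: "m A = ennreal (cycle_mean (indicator A))" if A: "A \<in> sets S" for A
  proof -
    have "(\<lambda>n. excursion n (indicator A) / mean_cycle_length) sums cycle_mean (indicator A)"
      unfolding cycle_mean_def using excursion_summable[of "indicator A"] A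
      by (intro sums_divide summable_sums) auto
    then show ?thesis
      unfolding m_def using nn[OF A] T0 by (intro suminf_ennreal_eq) auto
  qed
  define \<mu> where "\<mu> = measure_of (space S) (sets S) m"
  have sets_\<mu>: "sets \<mu> = sets S" "space \<mu> = space S" by (simp_all add: \<mu>_def)
  have "countably_additive (sets S) m"
  proof (rule countably_additiveI)
    fix A :: "nat \<Rightarrow> 'a set" assume A: "range A \<subseteq> sets S" "disjoint_family A"
    let ?g = "\<lambda>i n. ennreal (excursion n (indicator (A i)) / mean_cycle_length)"
    have "(\<Sum>i. m (A i)) = (\<Sum>i. \<integral>\<^sup>+n. ?g i n \<partial>count_space UNIV)"
      by (simp add: m_def nn_integral_count_space_nat)
    also have "\<dots> = (\<integral>\<^sup>+n. (\<Sum>i. ?g i n) \<partial>count_space UNIV)"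
      by (rule nn_integral_suminf[symmetric]) simp
    also have "\<dots> = (\<Sum>n. \<Sum>i. ?g i n)"
      by (simp add: nn_integral_count_space_nat)
    also have "\<dots> = m (\<Union>i. A i)"
      unfolding m_def
    proof (rule suminf_cong)
      fix n
      show "(\<Sum>i. ?g i n) = ennreal (excursion n (indicator (\<Union>i. A i)) / mean_cycle_length)"
        using A nn T0 by (intro suminf_ennreal_eq sums_divide excursion_sums_UN) auto
    qed
    finally show "(\<Sum>i. m (A i)) = m (\<Union>i. A i)" .
  qed
  moreover have "positive (sets S) m"
  proof -
    have "indicator {} = (\<lambda>_::'a. 0::real)" by (simp add: fun_eq_iff)
    then have "excursion n (indicator {}) = 0" for n
      using excursion_cmult[of "\<lambda>_. 0" n 0] by simp
    then show ?thesis by (simp add: positive_def m_def)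
  qed
  ultimately have em: "emeasure \<mu> A = ennreal (cycle_mean (indicator A))" if "A \<in> sets S" for A
    unfolding \<mu>_def using that m_eq[OF that] by (simp add: emeasure_measure_of_sigma sets.sigma_algebra_axioms)
  have ma_nn: "0 \<le> cycle_mean f" if "f \<in> bounded_measurable S" "\<And>x. x \<in> space S \<Longrightarrow> 0 \<le> f x" for f
    unfolding cycle_mean_def using that T0 by (intro divide_nonneg_pos suminf_nonneg excursion_summable excursion_nonneg)
  have meas: "measure \<mu> A = cycle_mean (indicator A)" if "A \<in> sets S" for A
    using em[OF that] ma_nn[of "indicator A"] that by (simp add: measure_def)
  have "cycle_mean (indicator (space S)) = cycle_mean (\<lambda>_. 1)"
  proof -
    have "excursion n (indicator (space S)) = excursion n (\<lambda>_. 1)" for n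
    proof -
      have "(\<integral>x. indicator (space S) x \<partial>step_law P \<nu> k) = (\<integral>x. 1 \<partial>step_law P \<nu> k :: real)" for k
        using step_law_in_prob_algebra[OF kernel \<nu>, of k]
        by (intro Bochner_Integration.integral_cong) (auto simp: space_prob_algebra dest: sets_eq_imp_space_eq)
      then show ?thesis by (simp only: excursion_def integral_op_iter bounded_measurable_indicator bounded_measurable_const sets.top)
    qed
    then show ?thesis by (simp add: cycle_mean_def)
  qed
  also have "\<dots> = 1" using T0 by (simp add: cycle_mean_def excursion_one mean_cycle_length_def)
  finally have \<mu>_prob: "\<mu> \<in> space (prob_algebra S)"
    using em[of "space S"] by (auto simp: space_prob_algebra sets_\<mu> intro!: prob_spaceI)
  have J: "cycle_mean f = (\<integral>x. f x \<partial>\<mu>)"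
    if "f \<in> bounded_measurable S" "\<And>x. x \<in> space S \<Longrightarrow> 0 \<le> f x \<and> f x \<le> 1" for f
  proof (rule positive_functional_eq_integral[OF \<mu>_prob _ _ ma_nn _ that])
    show "cycle_mean (\<lambda>x. f x + g x) = cycle_mean f + cycle_mean g"
      if "f \<in> bounded_measurable S" "g \<in> bounded_measurable S" for f g
      using that by (simp add: cycle_mean_def excursion_add suminf_add[symmetric] excursion_summable add_divide_distrib)
    show "cycle_mean (\<lambda>x. c * f x) = c * cycle_mean f" if "f \<in> bounded_measurable S" for c f
      using that by (simp add: cycle_mean_def excursion_cmult suminf_mult excursion_summable)
  qed (auto simp: meas)
  have "\<mu> \<bind> P = \<mu>"
  proof (rule measure_eqI)
    show "sets (\<mu> \<bind> P) = sets \<mu>"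
      using sets_bind'[OF \<mu>_prob kernel] sets_\<mu> by simp
    fix A assume "A \<in> sets (\<mu> \<bind> P)"
    then have A: "A \<in> sets S" using sets_bind'[OF \<mu>_prob kernel] by simp
    interpret b: prob_space "\<mu> \<bind> P" by (rule prob_space_bind'[OF \<mu>_prob kernel])
    interpret \<mu>: prob_space \<mu> using \<mu>_prob by (simp add: space_prob_algebra)
    have "measure (\<mu> \<bind> P) A = (\<integral>x. indicator A x \<partial>(\<mu> \<bind> P))"
      using A sets_bind'[OF \<mu>_prob kernel] by simp
    also have "\<dots> = (\<integral>x. \<T> (indicator A) x \<partial>\<mu>)"
      using A by (intro integral_bind_kernel[OF \<mu>_prob]) auto
    also have "\<dots> = cycle_mean (\<T> (indicator A))"
    proof (rule J[symmetric])
      fix x assume x: "x \<in> space S"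
      interpret prob_space "P x" using P_prob[OF x] by (simp add: space_prob_algebra)
      show "0 \<le> \<T> (indicator A) x \<and> \<T> (indicator A) x \<le> 1"
        using A P_prob[OF x] by (simp add: transition_op_def space_prob_algebra)
    qed (use A in auto)
    also have "\<dots> = measure \<mu> A"
      using A by (simp add: cycle_mean_invariant bounded_measurable_indicator meas)
    finally show "emeasure (\<mu> \<bind> P) A = emeasure \<mu> A"
      by (simp add: b.emeasure_eq_measure \<mu>.emeasure_eq_measure)
  qed
  with \<mu>_prob have "invariant_prob S P \<mu>" by (simp add: invariant_prob_def)
  then show thesis using meas by (rule that)
qed

text \<open>Already the start of the cycle charges \<open>C\<close>, since \<open>\<beta>' * \<nu>(C) = b 1\<close>.\<close>

lemma cycle_mean_C_pos:
  assumes "b 1 > 0"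
  shows "cycle_mean (indicator C) > 0"
proof -
  have "excursion 0 (indicator C) > 0"
    using increment_eq_excursion[of 0] assms \<beta>'_pos by (simp add: zero_less_mult_iff)
  also have "excursion 0 (indicator C) \<le> (\<Sum>n. excursion n (indicator C))"
  proof -
    have "0 \<le> excursion n (indicator C)" for n
      using C by (intro excursion_nonneg) auto
    then show ?thesis
      using sum_le_suminf[OF excursion_summable[of "indicator C"], of "{0}"] C by simp
  qed
  finally show ?thesis using mean_cycle_length_ge_1 by (simp add: cycle_mean_def)
qed

end

section \<open>Chebyshev iterates of a reversible transition operator\<close>

context reversible_kernel
begin

text \<open>The pair \<open>(T\<^sub>n(P) f, V\<^sub>n(P) f)\<close> of Chebyshev polynomials of the first and, shifted by one, of the
  second kind: \<open>T\<^sub>n(cos \<theta>) = cos (n \<theta>)\<close> and \<open>V\<^sub>n(cos \<theta>) = sin (n \<theta>) / sin \<theta>\<close>. The recursion is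
  the rotation by \<open>\<theta>\<close>.\<close>

primrec chebyshev_pair :: "('a \<Rightarrow> real) \<Rightarrow> nat \<Rightarrow> ('a \<Rightarrow> real) \<times> ('a \<Rightarrow> real)" where
  "chebyshev_pair f 0 = (f, \<lambda>_. 0)"
| "chebyshev_pair f (Suc n) = (let (h, k) = chebyshev_pair f n in
     (\<lambda>x. \<T> h x - (k x - \<T> (\<T> k) x), \<lambda>x. \<T> k x + h x))"

definition chebT where "chebT f n = fst (chebyshev_pair f n)"
definition chebU where "chebU f n = snd (chebyshev_pair f n)"

lemma cheb_simps:
  "chebT f 0 = f" "chebU f 0 = (\<lambda>_. 0)"
  "chebT f (Suc n) = (\<lambda>x. \<T> (chebT f n) x - (chebU f n x - \<T> (\<T> (chebU f n)) x))"
  "chebU f (Suc n) = (\<lambda>x. \<T> (chebU f n) x + chebT f n x)"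
  by (simp_all add: chebT_def chebU_def case_prod_beta Let_def)

lemma cheb_bounded_measurable:
  assumes "f \<in> bounded_measurable S"
  shows "chebT f n \<in> bounded_measurable S" "chebU f n \<in> bounded_measurable S"
proof (induction n)
  case (Suc n)
  show "chebT f (Suc n) \<in> bounded_measurable S" "chebU f (Suc n) \<in> bounded_measurable S"
    unfolding cheb_simps
    by (intro bounded_measurable_diff bounded_measurable_add op_bounded_measurable Suc.IH)+
qed (use assms in \<open>simp_all add: cheb_simps\<close>)

lemma chebT_Suc_0:
  assumes x: "x \<in> space S"
  shows "chebT f (Suc 0) x = \<T> f x"
proof -
  have "\<T> (\<T> (\<lambda>_. 0)) x = \<T> (\<lambda>_. 0) x" using x by (rule op_cong) (simp add: op_const)
  with x show ?thesis by (simp add: cheb_simps op_const)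
qed

lemma chebT_recurrence:
  assumes f: "f \<in> bounded_measurable S" and x: "x \<in> space S"
  shows "chebT f (Suc (Suc n)) x = 2 * \<T> (chebT f (Suc n)) x - chebT f n x"
proof -
  let ?h = "chebT f n" and ?k = "chebU f n"
  have h: "?h \<in> bounded_measurable S" and k: "?k \<in> bounded_measurable S"
    using cheb_bounded_measurable[OF f] by auto
  have Ph: "\<T> (chebT f (Suc n)) y = \<T> (\<T> ?h) y - (\<T> ?k y - \<T> (\<T> (\<T> ?k)) y)" if "y \<in> space S" for y
    unfolding cheb_simps(3) using that h k by (simp add: op_diff op_bounded_measurable bounded_measurable_diff)
  have PU: "\<T> (chebU f (Suc n)) y = \<T> (\<T> ?k) y + \<T> ?h y" if "y \<in> space S" for y
    unfolding cheb_simps(4) using that h k by (simp add: op_add op_bounded_measurable)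
  have "\<T> (\<T> (chebU f (Suc n))) x = \<T> (\<lambda>y. \<T> (\<T> ?k) y + \<T> ?h y) x"
    by (rule op_cong[OF x PU])
  then have PPU: "\<T> (\<T> (chebU f (Suc n))) x = \<T> (\<T> (\<T> ?k)) x + \<T> (\<T> ?h) x"
    using x h k by (simp add: op_add op_bounded_measurable)
  show ?thesis
    unfolding cheb_simps(3)[of f "Suc n"] cheb_simps(4) PPU
    using Ph[OF x] PPU by (simp add: cheb_simps(4))
qed

text \<open>The operator form of \<open>cos\<^sup>2 + sin\<^sup>2 = 1\<close>: the quantity is
  \<open>\<parallel>T\<^sub>n f\<parallel>\<^sup>2 + \<langle>(1 - P\<^sup>2) V\<^sub>n f, V\<^sub>n f\<rangle>\<close>, and self-adjointness makes the cross terms of the rotation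
  cancel.\<close>

lemma cheb_energy:
  assumes f: "f \<in> bounded_measurable S"
  shows "inner_pi (chebT f n) (chebT f n) + inner_pi (chebU f n) (chebU f n)
    - inner_pi (\<T> (chebU f n)) (\<T> (chebU f n)) = inner_pi f f"
proof (induction n)
  case 0
  have "inner_pi (\<T> (\<lambda>_. 0)) (\<T> (\<lambda>_. 0)) \<le> inner_pi (\<lambda>_. 0) (\<lambda>_. 0)" by (rule inner_pi_op_le) simp
  moreover have "inner_pi (\<lambda>_. 0) (\<lambda>_. 0) = 0" by (simp add: inner_pi_def)
  ultimately show ?case
    unfolding cheb_simps using inner_pi_nonneg[of "\<T> (\<lambda>_. 0)"] by linarith
next
  case (Suc n)
  let ?h = "chebT f n" and ?k = "chebU f n"
  have h: "?h \<in> bounded_measurable S" and k: "?k \<in> bounded_measurable S"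
    using cheb_bounded_measurable[OF f] by auto
  have PU: "inner_pi (\<T> (chebU f (Suc n))) (\<T> (chebU f (Suc n)))
      = inner_pi (\<lambda>y. \<T> (\<T> ?k) y + \<T> ?h y) (\<lambda>y. \<T> (\<T> ?k) y + \<T> ?h y)"
    unfolding cheb_simps(4) using h k by (intro inner_pi_cong) (simp_all add: op_add op_bounded_measurable)
  have adj: "inner_pi (\<T> ?h) ?k = inner_pi ?h (\<T> ?k)" "inner_pi (\<T> (\<T> ?k)) ?k = inner_pi (\<T> ?k) (\<T> ?k)"
    using h k by (simp_all add: inner_pi_op op_bounded_measurable)
  show ?case
    unfolding PU unfolding cheb_simps(3,4) Suc.IH[symmetric]
    using h k
    by (simp add: inner_pi_add_left inner_pi_add_right inner_pi_diff_left inner_pi_diff_right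
        op_bounded_measurable bounded_measurable_add bounded_measurable_diff adj
        inner_pi_commute[of ?k "\<T> ?h"] inner_pi_commute[of "\<T> (\<T> ?k)" "\<T> ?h"]
        inner_pi_commute[of ?k "\<T> (\<T> ?k)"] inner_pi_commute[of "\<T> ?k" "?h"])
qed

lemma chebT_norm_le:
  assumes f: "f \<in> bounded_measurable S"
  shows "inner_pi (chebT f n) (chebT f n) \<le> inner_pi f f"
  using cheb_energy[OF f, of n] inner_pi_op_le[OF cheb_bounded_measurable(2)[OF f, of n]] by linarith

lemma op_iter_norm_le:
  assumes f: "f \<in> bounded_measurable S"
  shows "inner_pi ((\<T> ^^ n) f) ((\<T> ^^ n) f) \<le> inner_pi f f"
proof (induction n)
  case (Suc n)
  with inner_pi_op_le[OF op_iter_bounded_measurable[OF f, of n]] show ?case by simp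
qed simp

end

section \<open>Reversible chains with a minorization\<close>

text \<open>The ratios \<open>s (n + 1) / s n\<close> increase. If one of them exceeded \<open>1 / \<rho>\<close>, all later ones would
  exceed it by a fixed factor, and \<open>s n * \<rho> ^ n\<close> would be unbounded. So an arbitrary bound for this
  sequence improves to its initial value.\<close>

lemma log_convex_decay:
  fixes s :: "nat \<Rightarrow> real"
  assumes nn: "\<And>n. 0 \<le> s n" and lc: "\<And>n. (s (Suc n))\<^sup>2 \<le> s n * s (Suc (Suc n))"
    and \<rho>: "\<rho> > 0" and bd: "\<And>n. s n * \<rho> ^ n \<le> B"
  shows "s n * \<rho> ^ n \<le> s 0"
proof -
  have step: "s (Suc n) * \<rho> \<le> s n" for n
  proof (rule ccontr)
    assume *: "\<not> ?thesis"
    define q where "q = s (Suc n) * \<rho> / s n"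
    have "s n \<noteq> 0"
    proof
      assume "s n = 0"
      with lc[of n] have "s (Suc n) = 0" by simp
      with * \<open>s n = 0\<close> show False by simp
    qed
    with nn[of n] have sn: "s n > 0" by simp
    with * have q1: "q > 1" by (simp add: q_def)
    have grow: "s (n + m) > 0 \<and> s (Suc (n + m)) * \<rho> \<ge> q * s (n + m)" for m
    proof (induction m)
      case 0
      with sn show ?case by (simp add: q_def)
    next
      case (Suc m)
      then have pos: "s (n + m) > 0" and ge: "s (Suc (n + m)) * \<rho> \<ge> q * s (n + m)" by auto
      have "0 < q * s (n + m)" using pos q1 by simp
      with ge have "0 < s (Suc (n + m)) * \<rho>" by linarith
      then have pos': "s (Suc (n + m)) > 0" using \<rho> by (simp add: zero_less_mult_iff)
      have "q * s (n + m) * s (Suc (n + m)) \<le> (s (Suc (n + m)) * \<rho>) * s (Suc (n + m))"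
        using ge pos' by (intro mult_right_mono) auto
      also have "\<dots> = \<rho> * (s (Suc (n + m)))\<^sup>2" by (simp add: power2_eq_square)
      also have "\<dots> \<le> \<rho> * (s (n + m) * s (Suc (Suc (n + m))))"
        using lc[of "n + m"] \<rho> by (intro mult_left_mono) auto
      finally have "s (n + m) * (q * s (Suc (n + m))) \<le> s (n + m) * (s (Suc (Suc (n + m))) * \<rho>)"
        by (simp only: mult_ac)
      then have "q * s (Suc (n + m)) \<le> s (Suc (Suc (n + m))) * \<rho>"
        using pos by (rule mult_left_le_imp_le)
      with pos' show ?case by simp
    qed
    have "s (n + m) * \<rho> ^ (n + m) \<ge> q ^ m * (s n * \<rho> ^ n)" for m
    proof (induction m)
      case (Suc m)
      have "q ^ Suc m * (s n * \<rho> ^ n) = q * (q ^ m * (s n * \<rho> ^ n))" by simp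
      also have "\<dots> \<le> q * (s (n + m) * \<rho> ^ (n + m))"
        using Suc q1 by (intro mult_left_mono) auto
      also have "\<dots> = (q * s (n + m)) * \<rho> ^ (n + m)" by simp
      also have "\<dots> \<le> (s (Suc (n + m)) * \<rho>) * \<rho> ^ (n + m)"
        using grow[of m] \<rho> by (intro mult_right_mono) auto
      finally show ?case by (simp add: mult_ac)
    qed simp
    then have le: "q ^ m * (s n * \<rho> ^ n) \<le> B" for m using bd[of "n + m"] by (rule order_trans)
    have c: "s n * \<rho> ^ n > 0" using sn \<rho> by simp
    obtain m where "B / (s n * \<rho> ^ n) < q ^ m" using real_arch_pow[OF q1] by blast
    with le[of m] c show False by (simp add: divide_less_eq)
  qed
  show ?thesis
  proof (induction n)
    case (Suc n)
    have "s (Suc n) * \<rho> ^ Suc n = (s (Suc n) * \<rho>) * \<rho> ^ n" by simp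
    also have "\<dots> \<le> s n * \<rho> ^ n" using step[of n] \<rho> by (intro mult_right_mono) auto
    finally show ?case using Suc by simp
  qed simp
qed

locale reversible_minorized_kernel = reversible_kernel S P \<pi> + minorized_kernel S P \<nu> C \<beta>' u b R L
  for S :: "'a measure" and P \<pi> \<nu> C \<beta>' u b R L +
  assumes pi_C_pos: "measure \<pi> C > 0"
begin

text \<open>Integrate the minorization over \<open>C\<close> with respect to the invariant measure.\<close>

lemma minorization_pi:
  assumes A: "A \<in> sets S"
  shows "\<beta>' * measure \<pi> C * measure \<nu> A \<le> measure \<pi> A"
proof -
  have "\<beta>' * measure \<pi> C * measure \<nu> A = (\<integral>x. \<beta>' * measure \<nu> A * indicator C x \<partial>\<pi>)"
    using C by (simp add: sets_pi)
  also have "\<dots> \<le> (\<integral>x. \<T> (indicator A) x \<partial>\<pi>)"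
  proof (intro integral_mono integrable_bounded_measurable[OF pi_prob] bounded_measurable_cmult
      bounded_measurable_indicator op_bounded_measurable C A)
    fix x assume "x \<in> space \<pi>"
    then have x: "x \<in> space S" by (simp add: space_pi)
    have "\<T> (indicator A) x = measure (P x) A"
      using A P_prob[OF x] by (simp add: transition_op_def space_prob_algebra)
    with minorization[OF x A] show "\<beta>' * measure \<nu> A * indicator C x \<le> \<T> (indicator A) x"
      by (simp add: mult_ac)
  qed
  also have "\<dots> = measure \<pi> A"
    using A by (simp add: integral_op bounded_measurable_indicator sets_pi)
  finally show ?thesis .
qed

text \<open>Jensen's inequality for \<open>\<nu>\<close> keeps the square inside the integral, so that only one of the two
  factors \<open>\<beta>'\<close> is spent on passing from \<open>\<nu>\<close> to \<open>\<pi>\<close>.\<close>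

lemma nu_integral_dominated:
  assumes h: "h \<in> bounded_measurable S"
  shows "(\<beta>' * (\<integral>x. h x \<partial>\<nu>))\<^sup>2 \<le> \<beta>' / measure \<pi> C * inner_pi h h"
proof -
  have "(\<beta>' * (\<integral>x. h x \<partial>\<nu>))\<^sup>2 = \<beta>'\<^sup>2 * (\<integral>x. h x \<partial>\<nu>)\<^sup>2" by (rule power_mult_distrib)
  also have "\<dots> \<le> \<beta>'\<^sup>2 * (\<integral>x. (h x)\<^sup>2 \<partial>\<nu>)"
    by (intro mult_left_mono integral_square_le[OF \<nu> h]) simp
  also have "\<dots> = \<beta>' / measure \<pi> C * (\<beta>' * measure \<pi> C * (\<integral>x. (h x)\<^sup>2 \<partial>\<nu>))"
    using pi_C_pos by (simp add: power2_eq_square)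
  also have "\<dots> \<le> \<beta>' / measure \<pi> C * (\<integral>x. (h x)\<^sup>2 \<partial>\<pi>)"
    using \<beta>'_pos pi_C_pos h
    by (intro mult_left_mono scaled_measure_integral_le[OF \<nu> pi_prob] minorization_pi) auto
  finally show ?thesis by (simp add: inner_pi_def power2_eq_square)
qed

text \<open>The array is \<open>w n k = \<beta>' \<integral> P\<^sup>k T\<^sub>n(P) 1\<^sub>C d\<nu>\<close>. It is bounded since \<open>P\<close> and all \<open>T\<^sub>n(P)\<close> are
  contractions, and its row \<open>n = 0\<close> is the renewal sequence from index \<open>1\<close> on.\<close>

lemma cut_plane_extension:
  obtains M where "M holomorphic_on {z. Im z = 0 \<longrightarrow> \<bar>Re z\<bar> < 1}"
    and "\<And>z. norm z < 1 \<Longrightarrow> M z = (\<Sum>k. of_real (u (Suc k)) * z ^ k)"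
proof -
  let ?f = "indicator C :: 'a \<Rightarrow> real"
  define w where "w n k = \<beta>' * (\<integral>x. (\<T> ^^ k) (chebT ?f n) x \<partial>\<nu>)" for n k
  have f: "?f \<in> bounded_measurable S" using C by (rule bounded_measurable_indicator)
  have s\<nu>: "space \<nu> = space S" using \<nu> by (auto simp: space_prob_algebra dest: sets_eq_imp_space_eq)
  note T = cheb_bounded_measurable(1)[OF f]
  have bd: "norm (complex_of_real (w n k)) \<le> sqrt (\<beta>' / measure \<pi> C * inner_pi ?f ?f)" for n k
  proof -
    have "(w n k)\<^sup>2 \<le> \<beta>' / measure \<pi> C * inner_pi ((\<T> ^^ k) (chebT ?f n)) ((\<T> ^^ k) (chebT ?f n))"
      unfolding w_def by (rule nu_integral_dominated[OF op_iter_bounded_measurable[OF T]])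
    also have "\<dots> \<le> \<beta>' / measure \<pi> C * inner_pi ?f ?f"
      using \<beta>'_pos pi_C_pos order_trans[OF op_iter_norm_le[OF T] chebT_norm_le[OF f]]
      by (intro mult_left_mono) auto
    finally have "(w n k)\<^sup>2 \<le> \<beta>' / measure \<pi> C * inner_pi ?f ?f" .
    then show ?thesis using real_le_rsqrt[of "\<bar>w n k\<bar>"] by simp
  qed
  have w1: "w (Suc 0) k = w 0 (Suc k)" for k
  proof -
    have "(\<integral>x. (\<T> ^^ k) (chebT ?f (Suc 0)) x \<partial>\<nu>) = (\<integral>x. (\<T> ^^ k) (\<T> ?f) x \<partial>\<nu>)"
      by (intro Bochner_Integration.integral_cong refl op_iter_cong) (auto simp: s\<nu> chebT_Suc_0)
    then show ?thesis by (simp add: w_def cheb_simps(1) funpow_swap1)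
  qed
  have w2: "w (Suc (Suc n)) k = 2 * w (Suc n) (Suc k) - w n k" for n k
  proof -
    have "(\<integral>x. (\<T> ^^ k) (chebT ?f (Suc (Suc n))) x \<partial>\<nu>)
        = (\<integral>x. 2 * (\<T> ^^ Suc k) (chebT ?f (Suc n)) x - (\<T> ^^ k) (chebT ?f n) x \<partial>\<nu>)"
    proof (rule Bochner_Integration.integral_cong[OF refl])
      fix x assume "x \<in> space \<nu>"
      then have x: "x \<in> space S" by (simp add: s\<nu>)
      have "(\<T> ^^ k) (chebT ?f (Suc (Suc n))) x = (\<T> ^^ k) (\<lambda>y. 2 * \<T> (chebT ?f (Suc n)) y - chebT ?f n y) x"
        using x by (rule op_iter_cong) (rule chebT_recurrence[OF f])
      also have "\<dots> = 2 * (\<T> ^^ k) (\<T> (chebT ?f (Suc n))) x - (\<T> ^^ k) (chebT ?f n) x"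
        using x T by (simp add: op_iter_diff op_iter_cmult op_bounded_measurable bounded_measurable_cmult)
      finally show "(\<T> ^^ k) (chebT ?f (Suc (Suc n))) x = 2 * (\<T> ^^ Suc k) (chebT ?f (Suc n)) x - (\<T> ^^ k) (chebT ?f n) x"
        by (simp add: funpow_swap1)
    qed
    also have "\<dots> = 2 * (\<integral>x. (\<T> ^^ Suc k) (chebT ?f (Suc n)) x \<partial>\<nu>) - (\<integral>x. (\<T> ^^ k) (chebT ?f n) x \<partial>\<nu>)"
      using integrable_bounded_measurable[OF \<nu> op_iter_bounded_measurable[OF T]] by (simp del: funpow.simps)
    finally show ?thesis by (simp only: w_def right_diff_distrib mult.left_commute)
  qed
  have w0: "w 0 k = u (Suc k)" for k by (simp add: w_def cheb_simps(1) u_Suc)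
  obtain M where M: "M holomorphic_on {z. Im z = 0 \<longrightarrow> \<bar>Re z\<bar> < 1}"
    "\<And>z. norm z < 1 \<Longrightarrow> M z = (\<Sum>k. of_real (w 0 k) * z ^ k)"
    by (rule chebyshev_cut_plane_extension[where w="\<lambda>n k. complex_of_real (w n k)", OF bd])
       (auto simp: w1 w2)
  show thesis by (rule that[OF M(1)]) (simp add: M(2) w0)
qed

lemma renewal_deviation_conv_radius:
  assumes \<beta>: "\<beta> > 0" "b 1 \<ge> \<beta>"
  shows "conv_radius (\<lambda>n. complex_of_real (u n - lim u)) \<ge> ereal (R2 \<beta> R L)"
proof -
  obtain M where M: "M holomorphic_on {z. Im z = 0 \<longrightarrow> \<bar>Re z\<bar> < 1}"
    "\<And>z. norm z < 1 \<Longrightarrow> M z = (\<Sum>k. of_real (u (Suc k)) * z ^ k)"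
    by (rule cut_plane_extension) blast
  show ?thesis
    by (rule renewal_conv_radius[OF renewal R2_bounds[OF \<beta>(1) R, of L] increment_gf_neq_1_below_R2[OF renewal \<beta> M]])
qed

lemma centred_correlation:
  shows "inner_pi ((\<T> ^^ m) (\<lambda>x. indicator C x - measure \<pi> C)) ((\<T> ^^ n) (\<lambda>x. indicator C x - measure \<pi> C))
    = (LINT x:C|\<pi>. (\<T> ^^ (m + n)) (indicator C) x) - (measure \<pi> C)\<^sup>2"
proof -
  let ?f = "indicator C :: 'a \<Rightarrow> real" and ?p = "measure \<pi> C" and ?h = "\<lambda>x. indicator C x - measure \<pi> C"
  have f: "?f \<in> bounded_measurable S" using C by (rule bounded_measurable_indicator)
  have h: "?h \<in> bounded_measurable S" using f by auto
  interpret prob_space \<pi> using pi_prob by (simp add: space_prob_algebra)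
  have iter: "(\<T> ^^ k) ?h x = (\<T> ^^ k) ?f x - ?p" if "x \<in> space S" for k x
    using that f by (simp add: op_iter_diff op_iter_const)
  have int: "(\<integral>x. (\<T> ^^ k) ?f x \<partial>\<pi>) = ?p" for k
  proof (induction k)
    case 0
    then show ?case using C by (simp add: sets_pi)
  next
    case (Suc k)
    then show ?case using integral_op[OF op_iter_bounded_measurable[OF f, of k]] by simp
  qed
  have "inner_pi ((\<T> ^^ m) ?h) ((\<T> ^^ n) ?h) = inner_pi ?h ((\<T> ^^ (m + n)) ?h)"
    by (rule inner_pi_op_iter[OF h h])
  also have "\<dots> = (\<integral>x. ?f x * (\<T> ^^ (m + n)) ?f x - ?p * ?f x - ?p * (\<T> ^^ (m + n)) ?f x + ?p * ?p \<partial>\<pi>)"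
    unfolding inner_pi_def by (rule Bochner_Integration.integral_cong[OF refl]) (simp add: iter space_pi algebra_simps)
  also have "\<dots> = (\<integral>x. ?f x * (\<T> ^^ (m + n)) ?f x \<partial>\<pi>) - ?p * ?p - ?p * ?p + ?p * ?p"
  proof -
    have i1: "integrable \<pi> (\<lambda>x. ?f x * (\<T> ^^ (m + n)) ?f x)" "integrable \<pi> ?f" "integrable \<pi> ((\<T> ^^ (m + n)) ?f)"
      by (intro integrable_bounded_measurable[OF pi_prob] bounded_measurable_mult op_iter_bounded_measurable f)+
    have "(\<integral>x. ?f x \<partial>\<pi>) = ?p" using int[of 0] by simp
    then show ?thesis using i1 int[of "m + n"] by (simp add: prob_space)
  qed
  finally show ?thesis
    by (simp add: set_lebesgue_integral_def power2_eq_square)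
qed

text \<open>Log-convexity of the norms of \<open>P\<^sup>n h\<close>, \<open>h = 1\<^sub>C - \<pi>(C)\<close>, turns the qualitative decay of the
  correlations into \<open>\<parallel>P\<^sup>n h\<parallel>\<^sup>2 \<le> \<pi>(C) / r ^ (2 * n)\<close>, and \<open>\<pi>(C)\<close> cancels against the norm of the
  functional \<open>\<beta>' \<nu>\<close>.\<close>

lemma geometric_bound:
  assumes \<beta>: "\<beta> > 0"
    and conv: "\<And>r. 0 < r \<Longrightarrow> r < R2 \<beta> R L \<Longrightarrow>
      convergent (\<lambda>n. \<bar>(LINT x:C|\<pi>. (\<T> ^^ n) (indicator C) x) - (measure \<pi> C)\<^sup>2\<bar> * r ^ n)"
  shows "\<bar>u (Suc n) - \<beta>' * measure \<pi> C\<bar> \<le> sqrt \<beta>' / R2 \<beta> R L ^ n"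
proof -
  let ?\<rho> = "R2 \<beta> R L" and ?p = "measure \<pi> C"
  have \<rho>1: "1 < ?\<rho>" by (rule R2_bounds[OF \<beta> R])
  define h where "h x = indicator C x - ?p" for x
  define a where "a n = (LINT x:C|\<pi>. (\<T> ^^ n) (indicator C) x) - ?p\<^sup>2" for n
  define s where "s n = inner_pi ((\<T> ^^ n) h) ((\<T> ^^ n) h)" for n
  have f: "indicator C \<in> bounded_measurable S" using C by (rule bounded_measurable_indicator)
  then have h: "h \<in> bounded_measurable S" unfolding h_def[abs_def] by auto
  have corr: "inner_pi ((\<T> ^^ m) h) ((\<T> ^^ n) h) = a (m + n)" for m n
    unfolding h_def[abs_def] a_def by (rule centred_correlation)
  have s_a: "s n = a (n + n)" for n unfolding s_def by (rule corr)
  have s_decay: "s n * (r * r) ^ n \<le> s 0" if r: "0 < r" "r < ?\<rho>" for r n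
  proof -
    obtain B where B: "\<And>n. norm (\<bar>a n\<bar> * r ^ n) \<le> B"
      using convergent_imp_Bseq[OF conv[OF r]] unfolding Bseq_def a_def by blast
    show ?thesis
    proof (rule log_convex_decay)
      show "0 \<le> s n" for n unfolding s_def by (rule inner_pi_nonneg)
      show "(s (Suc n))\<^sup>2 \<le> s n * s (Suc (Suc n))" for n
      proof -
        have "s (Suc n) = inner_pi ((\<T> ^^ n) h) ((\<T> ^^ Suc (Suc n)) h)"
          unfolding s_a corr by simp
        then show ?thesis
          unfolding s_def using inner_pi_Cauchy_Schwarz[OF op_iter_bounded_measurable[OF h] op_iter_bounded_measurable[OF h]]
          by metis
      qed
      show "s n * (r * r) ^ n \<le> B" for n
        using B[of "n + n"] r by (simp add: s_a power_mult_distrib power_add abs_mult)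
           (meson abs_ge_self mult_right_mono order_trans zero_le_mult_iff zero_le_power less_imp_le)
    qed (use r in simp)
  qed
  \<comment> \<open>The correlations are controlled only for \<open>r\<close> below the threshold; the bound without a spurious constant survives the limit.\<close>
  have "s n * (?\<rho> * ?\<rho>) ^ n \<le> s 0"
  proof (rule tendsto_le[OF _ tendsto_const])
    show "((\<lambda>r. s n * (r * r) ^ n) \<longlongrightarrow> s n * (?\<rho> * ?\<rho>) ^ n) (at_left ?\<rho>)"
      by (intro tendsto_intros)
    show "\<forall>\<^sub>F r in at_left ?\<rho>. s n * (r * r) ^ n \<le> s 0"
      using eventually_at_left_real[of 0 ?\<rho>] \<rho>1 s_decay by (auto elim!: eventually_mono)
  qed simp
  moreover have "s 0 \<le> ?p"
  proof -
    have "s 0 = a 0" by (simp add: s_a)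
    also have "a 0 = ?p - ?p\<^sup>2"
      using C by (simp add: a_def set_lebesgue_integral_def sets_pi indicator_inter_arith[symmetric])
    finally show ?thesis by simp
  qed
  ultimately have sn: "s n * (?\<rho> ^ n)\<^sup>2 \<le> ?p"
    by (simp add: power2_eq_square power_mult_distrib)
  have s\<nu>: "space \<nu> = space S" using \<nu> by (auto simp: space_prob_algebra dest: sets_eq_imp_space_eq)
  interpret \<nu>: prob_space \<nu> using \<nu> by (simp add: space_prob_algebra)
  have "u (Suc n) - \<beta>' * ?p = \<beta>' * (\<integral>x. (\<T> ^^ n) h x \<partial>\<nu>)"
  proof -
    have "(\<integral>x. (\<T> ^^ n) h x \<partial>\<nu>) = (\<integral>x. (\<T> ^^ n) (indicator C) x - ?p \<partial>\<nu>)"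
      unfolding h_def[abs_def] using f
      by (intro Bochner_Integration.integral_cong refl) (simp add: s\<nu> op_iter_diff op_iter_const)
    also have "\<dots> = (\<integral>x. (\<T> ^^ n) (indicator C) x \<partial>\<nu>) - ?p"
      using integrable_bounded_measurable[OF \<nu> op_iter_bounded_measurable[OF f]] by (simp add: \<nu>.prob_space)
    finally show ?thesis by (simp add: u_Suc right_diff_distrib)
  qed
  then have "(u (Suc n) - \<beta>' * ?p)\<^sup>2 \<le> \<beta>' / ?p * s n"
    unfolding s_def using nu_integral_dominated[OF op_iter_bounded_measurable[OF h]] by simp
  then have "(u (Suc n) - \<beta>' * ?p)\<^sup>2 * (?\<rho> ^ n)\<^sup>2 \<le> \<beta>' / ?p * (s n * (?\<rho> ^ n)\<^sup>2)"
    by (simp only: mult.assoc[symmetric] mult_right_mono zero_le_power2)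
  also have "\<dots> \<le> \<beta>' / ?p * ?p"
    using \<beta>'_pos pi_C_pos by (intro mult_left_mono sn) auto
  also have "\<dots> = \<beta>'" using pi_C_pos by simp
  finally have "(\<bar>u (Suc n) - \<beta>' * ?p\<bar> * ?\<rho> ^ n)\<^sup>2 \<le> \<beta>'"
    by (simp add: power_mult_distrib)
  then have "\<bar>u (Suc n) - \<beta>' * ?p\<bar> * ?\<rho> ^ n \<le> sqrt \<beta>'"
    by (rule real_le_rsqrt)
  then show ?thesis using \<rho>1 by (simp add: pos_le_divide_eq)
qed

lemma renewal_deviation_sum:
  assumes \<beta>: "\<beta> > 0" "b 1 \<ge> \<beta>"
    and conv: "\<And>r. 0 < r \<Longrightarrow> r < R2 \<beta> R L \<Longrightarrow>
      convergent (\<lambda>n. \<bar>(LINT x:C|\<pi>. (\<T> ^^ n) (indicator C) x) - (measure \<pi> C)\<^sup>2\<bar> * r ^ n)"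
    and r: "1 < r" "r < R2 \<beta> R L"
  shows "summable (\<lambda>n. \<bar>u (Suc n) - lim u\<bar> * r ^ Suc n)"
    and "(\<Sum>n. \<bar>u (Suc n) - lim u\<bar> * r ^ Suc n) \<le> sqrt \<beta>' * r / (1 - r / R2 \<beta> R L)"
proof -
  let ?\<rho> = "R2 \<beta> R L" and ?p = "measure \<pi> C"
  have \<rho>1: "1 < ?\<rho>" by (rule R2_bounds[OF \<beta>(1) R])
  note bound = geometric_bound[OF \<beta>(1) conv]
  have "(\<lambda>n. sqrt \<beta>' * inverse ?\<rho> ^ n) \<longlonglongrightarrow> 0"
    using \<rho>1 by (intro tendsto_mult_right_zero LIMSEQ_realpow_zero) (simp_all add: inverse_less_1_iff)
  then have "(\<lambda>n. sqrt \<beta>' / ?\<rho> ^ n) \<longlonglongrightarrow> 0"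
    by (simp add: divide_inverse power_inverse)
  then have "(\<lambda>n. u (Suc n) - \<beta>' * ?p) \<longlonglongrightarrow> 0"
    by (rule Lim_null_comparison[rotated]) (intro always_eventually allI, simp only: real_norm_def bound)
  then have "(\<lambda>n. u (Suc n)) \<longlonglongrightarrow> \<beta>' * ?p" by (rule LIM_zero_cancel)
  then have lim: "lim u = \<beta>' * ?p"
    by (intro limI) (rule LIMSEQ_imp_Suc)
  have q: "norm (r / ?\<rho>) < 1" using r \<rho>1 by simp
  have le: "\<bar>u (Suc n) - lim u\<bar> * r ^ Suc n \<le> sqrt \<beta>' * r * (r / ?\<rho>) ^ n" for n
  proof -
    have "\<bar>u (Suc n) - lim u\<bar> * r ^ Suc n \<le> (sqrt \<beta>' / ?\<rho> ^ n) * r ^ Suc n"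
      using bound[of n] r unfolding lim by (intro mult_right_mono) auto
    then show ?thesis by (simp add: power_divide mult_ac)
  qed
  have sm: "summable (\<lambda>n. sqrt \<beta>' * r * (r / ?\<rho>) ^ n)"
    using q by (intro summable_mult summable_geometric)
  show s: "summable (\<lambda>n. \<bar>u (Suc n) - lim u\<bar> * r ^ Suc n)"
    by (rule summable_comparison_test[OF _ sm]) (use le r in \<open>auto simp: abs_mult\<close>)
  have "(\<Sum>n. \<bar>u (Suc n) - lim u\<bar> * r ^ Suc n) \<le> (\<Sum>n. sqrt \<beta>' * r * (r / ?\<rho>) ^ n)"
    by (rule suminf_le[OF le s sm])
  also have "\<dots> = sqrt \<beta>' * r / (1 - r / ?\<rho>)"
    using q by (simp add: suminf_mult suminf_geometric summable_geometric)
  finally show "(\<Sum>n. \<bar>u (Suc n) - lim u\<bar> * r ^ Suc n) \<le> sqrt \<beta>' * r / (1 - r / ?\<rho>)" .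
qed

end

section \<open>Rate of convergence of the renewal sequence\<close>

theorem theorem3p3:
  fixes S :: "'a measure" and P :: "'a \<Rightarrow> 'a measure" and \<pi> \<nu> :: "'a measure"
    and C :: "'a set" and \<beta>' \<beta> R L :: real and u b :: "nat \<Rightarrow> real"
  assumes kernel: "P \<in> measurable S (prob_algebra S)"
    and invariant: "invariant_prob S P \<pi>"
    and unique_invariant: "\<And>\<mu>. invariant_prob S P \<mu> \<Longrightarrow> \<mu> = \<pi>"
    and reversible: "reversible_wrt S P \<pi>"
    and C: "C \<in> sets S"
    and \<beta>'_pos: "\<beta>' > 0"
    and \<nu>: "\<nu> \<in> space (prob_algebra S)"
    and minorization: "\<And>x A. x \<in> space S \<Longrightarrow> A \<in> sets S \<Longrightarrow>
          measure (P x) A \<ge> \<beta>' * indicator C x * measure \<nu> A"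
    and u_0: "u 0 = 1"
    and u_n: "\<And>n. n \<ge> 1 \<Longrightarrow> u n = \<beta>' * measure (chain_law S P \<nu>)
          {\<omega> \<in> space (chain_law S P \<nu>). \<omega> (n - 1) \<in> C}"
    and increments: "increment_sequence b"
    and renewal: "renewal_sequence_of b u"
    and R: "R > 1"
    and \<beta>_pos: "\<beta> > 0"
    and b_summable: "summable (\<lambda>n. b (Suc n) * R ^ Suc n)"
    and b_bound: "(\<Sum>n. b (Suc n) * R ^ Suc n) \<le> L"
    and b_1: "b 1 \<ge> \<beta>"
  shows "(L > 1 + 2 * \<beta> * R \<longrightarrow> (\<exists>!r. R2_solution \<beta> R L r))
    \<and> conv_radius (\<lambda>n. complex_of_real (u n - lim u)) \<ge> ereal (R2 \<beta> R L)
    \<and> ((\<forall>r. 0 < r \<and> r < R2 \<beta> R L \<longrightarrow>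
            convergent (\<lambda>n. \<bar>(LINT x:C|\<pi>. (transition_op P ^^ n) (indicator C) x)
                                - (measure \<pi> C)\<^sup>2\<bar> * r ^ n))
        \<longrightarrow> (\<forall>r. 1 < r \<and> r < R2 \<beta> R L \<longrightarrow>
              summable (\<lambda>n. \<bar>u (Suc n) - lim u\<bar> * r ^ Suc n)
              \<and> (\<Sum>n. \<bar>u (Suc n) - lim u\<bar> * r ^ Suc n)
                  \<le> sqrt \<beta>' * r / (1 - r / R2 \<beta> R L)))"
proof -
  interpret markov_kernel S P by unfold_locales (rule kernel)
  have u_Suc: "u (Suc n) = \<beta>' * (\<integral>x. (transition_op P ^^ n) (indicator C) x \<partial>\<nu>)" for n
  proof -
    have "u (Suc n) = \<beta>' * measure (step_law P \<nu> n) C"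
      using u_n[of "Suc n"] measure_chain_law[OF kernel \<nu> C, of n] by simp
    also have "measure (step_law P \<nu> n) C = (\<integral>x. indicator C x \<partial>step_law P \<nu> n)"
      using C step_law_in_prob_algebra[OF kernel \<nu>, of n] by (simp add: space_prob_algebra)
    also have "\<dots> = (\<integral>x. (transition_op P ^^ n) (indicator C) x \<partial>\<nu>)"
      using C by (intro integral_step_law[OF \<nu>]) auto
    finally show ?thesis .
  qed
  interpret reversible_kernel S P \<pi> by unfold_locales (fact invariant, fact reversible)
  interpret minorized_kernel S P \<nu> C \<beta>' u b R L
    by unfold_locales (fact C \<beta>'_pos \<nu> minorization u_Suc increments renewal R b_summable b_bound)+
  obtain \<mu> where "invariant_prob S P \<mu>" "\<And>A. A \<in> sets S \<Longrightarrow> measure \<mu> A = cycle_mean (indicator A)"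
    using invariant_prob_cycle_mean by blast
  then have "measure \<pi> C = cycle_mean (indicator C)" using unique_invariant C by metis
  then have "measure \<pi> C > 0" using cycle_mean_C_pos \<beta>_pos b_1 by simp
  then interpret reversible_minorized_kernel S P \<pi> \<nu> C \<beta>' u b R L by unfold_locales
  show ?thesis
    using R2_solution_ex1[OF \<beta>_pos R] renewal_deviation_conv_radius[OF \<beta>_pos b_1] renewal_deviation_sum[OF \<beta>_pos b_1]
    by blast
qed

end
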